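(* Let $\mathbf A\in\mathbb H^{m\times n}$, $\mathbf y\in\mathbb H^{1\times n}$, and let $\mathbf x^{0}=(x^0_1,\dots,x^0_m)$ be the least squares solution of least norm of the left system $\mathbf x\mathbf A=\mathbf y$. Put $\mathbf z=\mathbf y\mathbf A^{*}$. (i) If $\operatorname{rank}\mathbf A=m$, then for all $i=1,\dots,m$, $x_i^0=\dfrac{\operatorname{rdet}_i\big((\mathbf A\mathbf A^{*})_{i.}(\mathbf z)\big)}{\operatorname{ddet}\mathbf A}$. (ii) If $\operatorname{rank}\mathbf A=k\le n<m$, then for all $i=1,\dots,m$, $x_i^0=\dfrac{\sum_{\alpha\in I_{k,m}\{i\}}\operatorname{rdet}_i\Big(\big((\mathbf A\mathbf A^{*})_{i.}(\mathbf z)\big)^{\alpha}_{\alpha}\Big)}{\sum_{\alpha\in I_{k,m}}\big|(\mathbf A\mathbf A^{*})^{\alpha}_{\alpha}\big|}$.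
   Context: $\mathbb H$ is the quaternion skew field, $\mathbf A^*$ the conjugate transpose. The rank of a quaternion matrix is the maximal number of right-linearly independent columns (equivalently left-linearly independent rows). For a row $\mathbf x\in\mathbb H^{1\times m}$, $\|\mathbf x\|=\sqrt{\mathbf x\mathbf x^*}$. The least squares solution of least norm of $\mathbf x\mathbf A=\mathbf y$ is the row $\mathbf x^0$ of minimal norm among all $\tilde{\mathbf x}$ minimizing $\|\tilde{\mathbf x}\mathbf A-\mathbf y\|$. $\operatorname{ddet}\mathbf A:=\det(\mathbf A\mathbf A^* )$. Row and column determinants of $\mathbf M=(m_{ij})\in\mathbb H^{n\times n}$: $\operatorname{rdet}_i\mathbf M=\sum_{\sigma\in S_n}(-1)^{n-r}m_{i\,i_{k_1}}m_{i_{k_1}i_{k_1+1}}\cdots m_{i_{k_1+l_1}\,i}\cdots m_{i_{k_r}i_{k_r+1}}\cdots m_{i_{k_r+l_r}i_{k_r}}$ with $\sigma=(i\,i_{k_1}\dots i_{k_1+l_1})(i_{k_2}\dots i_{k_2+l_2})\cdots(i_{k_r}\dots i_{k_r+l_r})$ its decomposition into $r$ disjoint cycles (fixed points included), first cycle starting with $i$, other cycles starting with their smallest element, $i_{k_2}<\dots<i_{k_r}$; $\operatorname{cdet}_j$ is defined analogously with products read from the right. For Hermitian $\mathbf M$ all $\operatorname{rdet}_i\mathbf M$, $\operatorname{cdet}_j\mathbf M$ coincide and are real; the common value is $\det\mathbf M$. $\mathbf M_{i.}(\mathbf z)$ is $\mathbf M$ with its $i$th row replaced by the row $\mathbf z$.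 $L_{k,m}$ is the set of strictly increasing $k$-sequences from $\{1,\dots,m\}$, $I_{k,m}=L_{k,m}$, $I_{k,m}\{i\}=\{\alpha\in L_{k,m}:i\in\alpha\}$. $\mathbf M^{\alpha}_{\alpha}$ is the principal submatrix with rows and columns in $\alpha$; $|\mathbf M^\alpha_\alpha|=\det\mathbf M^\alpha_\alpha$ for Hermitian $\mathbf M$. In $\operatorname{rdet}_i(\mathbf N^\alpha_\alpha)$, $i\in\alpha$, the subscript refers to the row of the submatrix coming from row $i$ of $\mathbf N$. *)

theory Defs
  imports "HOL-Analysis.Analysis" "HOL-Combinatorics.Permutations"
begin

datatype quat = Quat (qre: real) (qi: real) (qj: real) (qk: real)

lemma quat_eqI: "qre x = qre y \<Longrightarrow> qi x = qi y \<Longrightarrow> qj x = qj y \<Longrightarrow> qk x = qk y \<Longrightarrow> x = y"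
  by (cases x; cases y) simp

instantiation quat :: ring_1
begin
definition "0 = Quat 0 0 0 0"
definition "1 = Quat 1 0 0 0"
definition "x + y = Quat (qre x + qre y) (qi x + qi y) (qj x + qj y) (qk x + qk y)"
definition "x - y = Quat (qre x - qre y) (qi x - qi y) (qj x - qj y) (qk x - qk y)"
definition "- x = Quat (- qre x) (- qi x) (- qj x) (- qk x)"
definition "x * y = Quat
   (qre x * qre y - qi x * qi y - qj x * qj y - qk x * qk y)
   (qre x * qi y + qi x * qre y + qj x * qk y - qk x * qj y)
   (qre x * qj y - qi x * qk y + qj x * qre y + qk x * qi y)
   (qre x * qk y + qi x * qj y - qj x * qi y + qk x * qre y)"
instance
  by standard (auto intro!: quat_eqI simp: zero_quat_def one_quat_def plus_quat_def
      minus_quat_def uminus_quat_def times_quat_def algebra_simps)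
end

instantiation quat :: division_ring
begin
definition "inverse x = (let n = (qre x)\<^sup>2 + (qi x)\<^sup>2 + (qj x)\<^sup>2 + (qk x)\<^sup>2 in
   Quat (qre x / n) (- qi x / n) (- qj x / n) (- qk x / n))"
definition "(x :: quat) div y = x * inverse y"

lemma quat_nsq_nz: "(x::quat) \<noteq> 0 \<Longrightarrow> (qre x)\<^sup>2 + (qi x)\<^sup>2 + (qj x)\<^sup>2 + (qk x)\<^sup>2 \<noteq> 0"
proof
  assume "x \<noteq> 0" "(qre x)\<^sup>2 + (qi x)\<^sup>2 + (qj x)\<^sup>2 + (qk x)\<^sup>2 = 0"
  then have "qre x = 0" "qi x = 0" "qj x = 0" "qk x = 0"
    by (smt (verit) zero_le_power2 zero_eq_power2)+
  then have "x = 0" by (auto intro: quat_eqI simp: zero_quat_def)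
  with \<open>x \<noteq> 0\<close> show False by simp
qed

instance
proof
  fix x :: quat
  assume nz: "x \<noteq> 0"
  define n where "n = (qre x)\<^sup>2 + (qi x)\<^sup>2 + (qj x)\<^sup>2 + (qk x)\<^sup>2"
  have n: "n \<noteq> 0" using quat_nsq_nz[OF nz] n_def by simp
  show "inverse x * x = 1" "x * inverse x = 1"
    using n by (auto intro!: quat_eqI simp: inverse_quat_def times_quat_def one_quat_def
        Let_def n_def[symmetric] field_simps) (simp_all add: n_def power2_eq_square add_divide_distrib[symmetric] algebra_simps)
next
  show "inverse (0::quat) = 0" by (simp add: inverse_quat_def zero_quat_def)
qed (simp add: divide_quat_def)
end

definition qcnj :: "quat \<Rightarrow> quat" where
  "qcnj x = Quat (qre x) (- qi x) (- qj x) (- qk x)"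

definition qnorm2 :: "quat \<Rightarrow> real" where
  "qnorm2 x = (qre x)\<^sup>2 + (qi x)\<^sup>2 + (qj x)\<^sup>2 + (qk x)\<^sup>2"

text \<open>Matrices are functions nat => nat => quat with 0-based indices and explicit sizes;
  rows are functions nat => quat.\<close>

type_synonym qmat = "nat \<Rightarrow> nat \<Rightarrow> quat"
type_synonym qrow = "nat \<Rightarrow> quat"

definition AAstar :: "nat \<Rightarrow> qmat \<Rightarrow> qmat" where
  "AAstar n A = (\<lambda>i j. \<Sum>l<n. A i l * qcnj (A j l))"

definition row_mult_star :: "nat \<Rightarrow> qrow \<Rightarrow> qmat \<Rightarrow> qrow" where
  "row_mult_star n y A = (\<lambda>j. \<Sum>l<n. y l * qcnj (A j l))"

definition row_mult :: "nat \<Rightarrow> qrow \<Rightarrow> qmat \<Rightarrow> qrow" where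
  "row_mult m x A = (\<lambda>j. \<Sum>i<m. x i * A i j)"

definition row_norm :: "nat \<Rightarrow> qrow \<Rightarrow> real" where
  "row_norm m x = sqrt (\<Sum>i<m. qnorm2 (x i))"

definition replace_row :: "qmat \<Rightarrow> nat \<Rightarrow> qrow \<Rightarrow> qmat" where
  "replace_row M i z = (\<lambda>r c. if r = i then z c else M r c)"

definition right_lin_indep_cols :: "nat \<Rightarrow> qmat \<Rightarrow> nat set \<Rightarrow> bool" where
  "right_lin_indep_cols m A J \<longleftrightarrow>
     (\<forall>q :: nat \<Rightarrow> quat. (\<forall>r<m. (\<Sum>j\<in>J. A r j * q j) = 0) \<longrightarrow> (\<forall>j\<in>J. q j = 0))"

definition qrank :: "nat \<Rightarrow> nat \<Rightarrow> qmat \<Rightarrow> nat" where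
  "qrank m n A = Max {card J | J. J \<subseteq> {..<n} \<and> right_lin_indep_cols m A J}"

definition lsq_least_norm :: "nat \<Rightarrow> nat \<Rightarrow> qmat \<Rightarrow> qrow \<Rightarrow> qrow \<Rightarrow> bool" where
  "lsq_least_norm m n A y x0 \<longleftrightarrow>
     (let res = (\<lambda>x. row_norm n (\<lambda>j. row_mult m x A j - y j)) in
       (\<forall>x. res x0 \<le> res x) \<and>
       (\<forall>x. (\<forall>x'. res x \<le> res x') \<longrightarrow> row_norm m x0 \<le> row_norm m x))"

text \<open>Row determinant on the (principal) submatrix of M with rows/columns in the finite
  index set S, indices in S taken in increasing order. For a permutation s of S and a start
  point j, cyc_prod gives m_{j s(j)} m_{s(j) s^2(j)} ... m_{s^l(j) j}.\<close>

definition cyc_len :: "(nat \<Rightarrow> nat) \<Rightarrow> nat \<Rightarrow> nat" where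
  "cyc_len s j = card {(s ^^ t) j | t. True}"

definition cyc_prod :: "qmat \<Rightarrow> (nat \<Rightarrow> nat) \<Rightarrow> nat \<Rightarrow> quat" where
  "cyc_prod M s j = prod_list (map (\<lambda>t. M ((s ^^ t) j) ((s ^^ Suc t) j)) [0..<cyc_len s j])"

definition cyc_leaders :: "nat set \<Rightarrow> (nat \<Rightarrow> nat) \<Rightarrow> nat \<Rightarrow> nat set" where
  "cyc_leaders S s i = {j \<in> S. j \<notin> {(s ^^ t) i | t. True} \<and> j = Min {(s ^^ t) j | t. True}}"

definition rdet :: "nat \<Rightarrow> nat set \<Rightarrow> qmat \<Rightarrow> quat" where
  "rdet i S M = (\<Sum>s\<in>{s. s permutes S}.
      of_int ((-1) ^ (card S - (1 + card (cyc_leaders S s i)))) *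
      (cyc_prod M s i * prod_list (map (cyc_prod M s) (sorted_list_of_set (cyc_leaders S s i)))))"

text \<open>Determinant of a Hermitian (principal sub)matrix: common value of the row determinants
  (take the first row; the empty determinant is 1).\<close>
definition hdet :: "nat set \<Rightarrow> qmat \<Rightarrow> quat" where
  "hdet S M = (if S = {} then 1 else rdet (Min S) S M)"

definition ddet :: "nat \<Rightarrow> nat \<Rightarrow> qmat \<Rightarrow> quat" where
  "ddet m n A = hdet {..<m} (AAstar n A)"

end

theory Submission
  imports Defs "HOL-Combinatorics.Cycles" "HOL-Combinatorics.Orbits"
begin

text \<open>
  Splitting off the cycle through \<open>i\<close> turns a row determinant into a signed sum over closed walks
  from \<open>i\<close> along distinct indices, weighted by determinants of complementary principal submatrices.
  For Hermitian \<open>H\<close> reversing a closed walk conjugates its product, so these determinants are real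
  and independent of the row of expansion, and replacing row \<open>i\<close> by another row gives \<open>0\<close>. Hence the
  cofactors form a genuine adjugate.

  Let \<open>H = A A\<^sup>*\<close>, let \<open>d p\<close> be the sum of the principal minors of order \<open>p\<close> and \<open>C p\<close> the matrix of sums
  of cofactors of principal submatrices of order \<open>p\<close>. Then \<open>H C p + C (p + 1) = d p I\<close>. A principal minor of \<open>H\<close>
  is positive if the corresponding rows of \<open>A\<close> are independent and zero otherwise, so \<open>d p = 0\<close> above
  the rank \<open>k\<close> of \<open>A\<close>, which forces \<open>H C (k + 1) = 0\<close>, while \<open>d k \<noteq> 0\<close>. The minimal solution satisfies
  \<open>x H = z\<close> and is orthogonal to the left kernel of \<open>A\<close>, so \<open>x C (k + 1) = 0\<close> and \<open>z C k = d k x\<close>.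
\<close>

section \<open>Cycle expansion of row determinants\<close>

definition simple_lists :: "'a set \<Rightarrow> 'a list set" where
  "simple_lists S = {w. distinct w \<and> set w \<subseteq> S}"

text \<open>The endpoints stay outside the list: taking \<open>b = a\<close> gives a closed walk,
  and the empty list is a single edge or a loop.\<close>

fun path_prod :: "qmat \<Rightarrow> nat \<Rightarrow> nat list \<Rightarrow> nat \<Rightarrow> quat" where
  "path_prod M a [] b = M a b"
| "path_prod M a (c # w) b = M a c * path_prod M c w b"

lemma finite_simple_lists: "finite S \<Longrightarrow> finite (simple_lists S)"
  unfolding simple_lists_def
  using finite_subset_distinct[of S] by (simp add: conj_commute)

lemma path_prod_eq_prod_list:
  "path_prod M a w b =
    prod_list (map (\<lambda>t. M ((a # w @ [b]) ! t) ((a # w @ [b]) ! Suc t)) [0..<Suc (length w)])"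
proof (induction w arbitrary: a)
  case (Cons c w)
  have "[0..<Suc (length (c # w))] = 0 # map Suc [0..<Suc (length w)]"
    by (metis map_Suc_upt upt_conv_Cons zero_less_Suc length_Cons)
  then show ?case using Cons by (simp add: comp_def del: upt_Suc)
qed simp

text \<open>The index modulo the length closes the cycle. Together with \<open>distinct L\<close>
  this says that \<open>L\<close> is one cycle of \<open>s\<close>, written once from its
  head.\<close>

definition cycles_along :: "('a \<Rightarrow> 'a) \<Rightarrow> 'a list \<Rightarrow> bool" where
  "cycles_along s L \<longleftrightarrow> (\<forall>t < length L. s (L ! t) = L ! (Suc t mod length L))"

lemma cycles_along_funpow:
  assumes "cycles_along s (i # w)"
  shows "(s ^^ t) i = (i # w) ! (t mod length (i # w))"
proof (induction t)
  case (Suc t)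
  then show ?case using assms by (simp add: cycles_along_def mod_Suc_eq)
qed simp

lemma cycles_along_orbit:
  assumes "cycles_along s (i # w)"
  shows "{(s ^^ t) i | t. True} = set (i # w)"
proof (intro set_eqI iffI)
  fix x assume "x \<in> set (i # w)"
  then obtain t where "t < length (i # w)" "x = (i # w) ! t" by (metis in_set_conv_nth)
  then show "x \<in> {(s ^^ t) i | t. True}"
    using cycles_along_funpow[OF assms, of t] by (metis (mono_tags, lifting) mem_Collect_eq mod_less)
next
  fix x assume "x \<in> {(s ^^ t) i | t. True}"
  then obtain t where "x = (s ^^ t) i" by blast
  then show "x \<in> set (i # w)" using cycles_along_funpow[OF assms, of t]
    by (metis nth_mem length_greater_0_conv list.distinct(1) mod_less_divisor)
qed

lemma cycles_along_cyc_len: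
  assumes "cycles_along s (i # w)" "distinct (i # w)"
  shows "cyc_len s i = Suc (length w)"
  using assms(2) unfolding cyc_len_def cycles_along_orbit[OF assms(1)]
  by (simp add: distinct_card del: set_simps)

lemma cycles_along_cyc_prod:
  assumes "cycles_along s (i # w)" "distinct (i # w)"
  shows "cyc_prod M s i = path_prod M i w i"
proof -
  have "(s ^^ t) i = (i # w @ [i]) ! t" if "t \<le> Suc (length w)" for t
    using that cycles_along_funpow[OF assms(1), of t]
    by (cases "t = Suc (length w)") (auto simp: nth_append nth_Cons split: nat.splits)
  then show ?thesis unfolding cyc_prod_def path_prod_eq_prod_list cycles_along_cyc_len[OF assms]
    by (intro arg_cong[where f = prod_list] map_cong) (auto simp del: funpow.simps)
qed

text \<open>This is the walk that the cycle expansion extracts from a permutation. The start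
  \<open>i\<close> is dropped, so a fixed point gives the empty list.\<close>

definition cycle_tail :: "(nat \<Rightarrow> nat) \<Rightarrow> nat \<Rightarrow> nat list" where
  "cycle_tail s i = map (\<lambda>t. (s ^^ Suc t) i) [0..<cyc_len s i - 1]"

lemma cycle_tail_unique:
  assumes "cycles_along s (i # w)" "distinct (i # w)"
  shows "cycle_tail s i = w"
proof (rule nth_equalityI)
  show "length (cycle_tail s i) = length w"
    by (simp add: cycle_tail_def cycles_along_cyc_len[OF assms])
  fix t assume "t < length (cycle_tail s i)"
  then have t: "t < length w" by (simp add: cycle_tail_def cycles_along_cyc_len[OF assms])
  then have "cycle_tail s i ! t = (s ^^ Suc t) i"
    by (simp add: cycle_tail_def cycles_along_cyc_len[OF assms] del: funpow.simps)
  then show "cycle_tail s i ! t = w ! t"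
    using cycles_along_funpow[OF assms(1), of "Suc t"] t by simp
qed

lemma cycle_tail:
  assumes "permutation s"
  shows "cycles_along s (i # cycle_tail s i)" "distinct (i # cycle_tail s i)"
proof -
  \<comment> \<open>The first return time of \<open>i\<close>: the powers before it are pairwise
    distinct and exhaust the orbit, so it is the cycle length.\<close>
  define c where "c = funpow_dist1 s i i"
  have self: "i \<in> orbit s i" using permutation_self_in_orbit[OF assms] .
  have c: "(s ^^ c) i = i" "c > 0" using funpow_dist1_prop[OF self] by (auto simp: c_def)
  have inj: "inj_on (\<lambda>t. (s ^^ t) i) {0..<c}" using inj_on_funpow_dist1[OF self] by (simp add: c_def)
  have "{(s ^^ t) i | t. True} = (\<lambda>t. (s ^^ t) i) ` {0..<c}"
    using orbit_conv_funpow_dist1[OF self] orbit_altdef_permutation[OF assms, of i]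
    by (simp add: c_def)
  then have len: "cyc_len s i = c"
    unfolding cyc_len_def using card_image[OF inj] by simp
  have L: "i # cycle_tail s i = map (\<lambda>t. (s ^^ t) i) [0..<c]"
  proof -
    have "[0..<c] = 0 # map Suc [0..<c - 1]"
      using c(2) by (metis Suc_pred' map_Suc_upt upt_conv_Cons)
    then show ?thesis unfolding cycle_tail_def len by (simp add: comp_def)
  qed
  show "distinct (i # cycle_tail s i)" unfolding L using inj by (simp add: distinct_map)
  show "cycles_along s (i # cycle_tail s i)" unfolding L cycles_along_def
  proof (intro allI impI)
    fix t assume "t < length (map (\<lambda>t. (s ^^ t) i) [0..<c])"
    then have t: "t < c" by simp
    show "s (map (\<lambda>t. (s ^^ t) i) [0..<c] ! t) =
        map (\<lambda>t. (s ^^ t) i) [0..<c] ! (Suc t mod length (map (\<lambda>t. (s ^^ t) i) [0..<c]))"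
      using t c by (cases "Suc t = c") auto
  qed
qed

lemma set_cycle_tail:
  assumes "permutation s"
  shows "insert i (set (cycle_tail s i)) = {(s ^^ t) i | t. True}"
  using cycles_along_orbit[OF cycle_tail(1)[OF assms]] by simp

lemma cycles_along_cycle_of_list:
  assumes "distinct L" "\<And>x. x \<in> set L \<Longrightarrow> s x = x"
  shows "cycles_along (cycle_of_list L \<circ> s) L"
  unfolding cycles_along_def
proof (intro allI impI)
  fix t assume t: "t < length L"
  have "map (cycle_of_list L) L = rotate1 L"
    using cyclic_rotation[OF assms(1), of 1] by simp
  then have "cycle_of_list L (L ! t) = rotate1 L ! t" using t by (metis nth_map)
  then show "(cycle_of_list L \<circ> s) (L ! t) = L ! (Suc t mod length L)"
    using t assms(2) by (simp add: nth_rotate1)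
qed

lemma funpow_orbit_cong:
  assumes "s permutes T" "\<And>x. x \<in> T \<Longrightarrow> s' x = s x" "j \<in> T"
  shows "(s' ^^ t) j = (s ^^ t) j" "(s ^^ t) j \<in> T"
  using assms by (induction t) (auto simp: permutes_in_image)

lemma cyc_prod_cong:
  assumes "\<And>t. (s' ^^ t) j = (s ^^ t) j"
  shows "cyc_prod M s' j = cyc_prod M s j"
  unfolding cyc_prod_def cyc_len_def assms ..

text \<open>Every cycle inside \<open>T\<close> has its minimum as leader. The cycle of
  \<open>Min T\<close> stays in \<open>T\<close>, so \<open>Min T\<close> is itself a leader and the
  smallest one; it becomes the distinguished start in \<open>T\<close>, and the other leaders are
  those of \<open>s'\<close> relative to this start.\<close>

lemma cyc_leaders_decomp:
  assumes fin: "finite S" and s: "s permutes S" and i: "i \<in> S"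
    and T: "T = S - {(s ^^ t) i | t. True}"
    and s': "s' permutes T" "\<And>x. x \<in> T \<Longrightarrow> s x = s' x" and ne: "T \<noteq> {}"
  shows "cyc_leaders S s i = insert (Min T) (cyc_leaders T s' (Min T))"
    and "\<forall>j \<in> cyc_leaders T s' (Min T). Min T < j"
proof -
  have finT: "finite T" using fin T by simp
  have pw: "(s ^^ t) j = (s' ^^ t) j" "(s' ^^ t) j \<in> T" if "j \<in> T" for t j
    using funpow_orbit_cong[OF s' that] by auto
  have orb: "{(s ^^ t) j | t. True} = {(s' ^^ t) j | t. True}" if "j \<in> T" for j
    using pw that by simp
  have perm': "permutation s'" using s'(1) finT by (auto simp: permutation_permutes)
  have mT: "Min T \<in> T" using finT ne by simp
  have sub: "{(s' ^^ t) j | t. True} \<subseteq> T" if "j \<in> T" for j using pw that by auto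
  have minT: "Min T = Min {(s' ^^ t) (Min T) | t. True}"
  proof (rule sym, rule Min_eqI)
    show "finite {(s' ^^ t) (Min T) |t. True}" using sub[OF mT] finT finite_subset by blast
    show "Min T \<in> {(s' ^^ t) (Min T) |t. True}" by (auto intro: exI[of _ 0])
    show "Min T \<le> y" if "y \<in> {(s' ^^ t) (Min T) |t. True}" for y
      using that sub[OF mT] finT by auto
  qed
  have lead: "cyc_leaders S s i = {j \<in> T. j = Min {(s' ^^ t) j | t. True}}"
    unfolding cyc_leaders_def using orb T by auto
  \<comment> \<open>Two leaders on the same cycle are minima of the same orbit, hence equal.\<close>
  have uniq: "j = Min T" if "j \<in> T" "j = Min {(s' ^^ t) j | t. True}"
    "j \<in> {(s' ^^ t) (Min T) | t. True}" for j
  proof -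
    have o: "orbit s' x = {(s' ^^ t) x | t. True}" for x by (rule orbit_altdef_permutation[OF perm'])
    have "orbit s' j = orbit s' (Min T)"
      using orbit_cyclic_eq3[OF cyclic_on_orbit'[OF perm']] that(3) o by blast
    then have "{(s' ^^ t) j | t. True} = {(s' ^^ t) (Min T) | t. True}" using o by blast
    then show ?thesis using that(2) minT by argo
  qed
  show "cyc_leaders S s i = insert (Min T) (cyc_leaders T s' (Min T))"
    unfolding lead unfolding cyc_leaders_def using uniq minT mT by blast
  have "Min T \<in> {(s' ^^ t) (Min T) | t. True}" by (auto intro: exI[of _ 0])
  then show "\<forall>j \<in> cyc_leaders T s' (Min T). Min T < j"
    unfolding cyc_leaders_def using finT by (metis (no_types, lifting) Min_le mem_Collect_eq order_le_less)
qed

section \<open>Peeling the cycle through the expansion row off a permutation\<close>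

definition rdet_term :: "nat \<Rightarrow> nat set \<Rightarrow> qmat \<Rightarrow> (nat \<Rightarrow> nat) \<Rightarrow> quat" where
  "rdet_term i S M s = of_int ((-1) ^ (card S - (1 + card (cyc_leaders S s i)))) *
      (cyc_prod M s i * prod_list (map (cyc_prod M s) (sorted_list_of_set (cyc_leaders S s i))))"

lemma rdet_eq_sum_rdet_term: "rdet i S M = (\<Sum>s\<in>{s. s permutes S}. rdet_term i S M s)"
  by (simp add: rdet_def rdet_term_def)

text \<open>The empty set has exactly one permutation, so the convention that the empty determinant
  is 1 also fits the form of a sum over permutations.\<close>

lemma hdet_eq_sum:
  "hdet T M = (\<Sum>s\<in>{s. s permutes T}. if T = {} then 1 else rdet_term (Min T) T M s)"
  by (simp add: hdet_def rdet_eq_sum_rdet_term)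

lemma of_int_mult_rotate:
  fixes P Q :: "'a::ring_1"
  shows "of_int x * of_int y * (P * Q) = of_int x * P * (of_int y * Q)"
proof -
  have "of_int y * (P * Q) = P * (of_int y * Q)"
    unfolding mult.assoc[symmetric] mult_of_int_commute[of y P] ..
  then show ?thesis by (simp only: mult.assoc)
qed

text \<open>The exponent of the sign is the number of points minus the number of cycles, so removing
  a cycle with \<open>Suc (length w)\<close> points leaves \<open>(-1) ^ length w\<close>. The
  remaining cycle products already stand in the order prescribed for the start \<open>Min T\<close>,
  so no two of them have to be commuted.\<close>

lemma rdet_term_decomp:
  assumes fin: "finite S" and s: "s permutes S" and i: "i \<in> S"
    and w: "cycles_along s (i # w)" "distinct (i # w)" "set w \<subseteq> S"
    and T: "T = S - insert i (set w)"
    and s': "s' permutes T" "\<And>x. x \<in> T \<Longrightarrow> s x = s' x"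
  shows "rdet_term i S M s = (-1) ^ length w * path_prod M i w i *
    (if T = {} then 1 else rdet_term (Min T) T M s')"
proof -
  have orb: "{(s ^^ t) i | t. True} = insert i (set w)" using cycles_along_orbit[OF w(1)] by simp
  have cardS: "card S = Suc (length w) + card T"
  proof -
    have "card (insert i (set w)) = Suc (length w)"
      using distinct_card[OF w(2)] by simp
    moreover have "card T = card S - card (insert i (set w))"
      unfolding T using w(3) i fin by (intro card_Diff_subset) (auto intro: finite_subset)
    moreover have "card (insert i (set w)) \<le> card S"
      using w(3) i fin by (intro card_mono) auto
    ultimately show ?thesis by simp
  qed
  have cp: "cyc_prod M s i = path_prod M i w i" by (rule cycles_along_cyc_prod[OF w(1,2)])
  show ?thesis
  proof (cases "T = {}")
    case True
    then have "cyc_leaders S s i = {}" unfolding cyc_leaders_def orb using T by auto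
    then show ?thesis using True cardS by (simp add: rdet_term_def cp)
  next
    case False
    have T': "T = S - {(s ^^ t) i | t. True}" unfolding T orb ..
    have finT: "finite T" using fin T by simp
    define K where "K = cyc_leaders T s' (Min T)"
    have lead: "cyc_leaders S s i = insert (Min T) K"
      and lt: "\<forall>j\<in>K. Min T < j"
      using cyc_leaders_decomp[OF fin s i T' s' False] by (auto simp: K_def)
    have KT: "K \<subseteq> T" by (auto simp: K_def cyc_leaders_def)
    have finK: "finite K" using KT finT finite_subset by blast
    have nK: "Min T \<notin> K" using lt by blast
    have sl: "sorted_list_of_set (insert (Min T) K) = Min T # sorted_list_of_set K"
    proof -
      have "Min (insert (Min T) K) = Min T"
        by (rule Min_eqI) (use finK lt in \<open>auto intro: less_imp_le\<close>)
      then show ?thesis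
        using sorted_list_of_set_nonempty[of "insert (Min T) K"] finK nK by simp
    qed
    have cps: "cyc_prod M s j = cyc_prod M s' j" if "j \<in> T" for j
      using funpow_orbit_cong[OF s' that] by (intro cyc_prod_cong) auto
    have mT: "Min T \<in> T" using finT False by simp
    have mp: "map (cyc_prod M s) (sorted_list_of_set K) = map (cyc_prod M s') (sorted_list_of_set K)"
      using cps KT finK by auto
    \<comment> \<open>There are at most as many cycles as points; this makes the truncated
      subtraction in the sign exact.\<close>
    have "card (insert (Min T) K) \<le> card T" using KT mT finT by (intro card_mono) auto
    then have "card S - (1 + card (insert (Min T) K)) = length w + (card T - (1 + card K))"
      using cardS finK nK by simp
    then have "rdet_term i S M s = of_int ((-1) ^ length w) * of_int ((-1) ^ (card T - (1 + card K))) *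
        (path_prod M i w i * (cyc_prod M s' (Min T) *
          prod_list (map (cyc_prod M s') (sorted_list_of_set K))))"
      by (simp add: rdet_term_def lead sl cp cps[OF mT] mp power_add)
    also have "\<dots> = of_int ((-1) ^ length w) * path_prod M i w i * rdet_term (Min T) T M s'"
      unfolding rdet_term_def K_def[symmetric] by (rule of_int_mult_rotate)
    finally show ?thesis using False by simp
  qed
qed

text \<open>A permutation of \<open>S\<close> amounts to its cycle through \<open>i\<close> and a
  permutation of the remaining indices. Summing over the latter yields the determinant of the
  complement.\<close>

lemma rdet_cycle_expansion:
  assumes fin: "finite S" and i: "i \<in> S"
  shows "rdet i S M = (\<Sum>w\<in>simple_lists (S - {i}).
      (-1) ^ length w * path_prod M i w i * hdet (S - insert i (set w)) M)"
proof -
  define X where "X = Sigma (simple_lists (S - {i})) (\<lambda>w. {s'. s' permutes (S - insert i (set w))})"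
  have perm: "permutation s" if "s permutes S" for s using that fin by (auto simp: permutation_permutes)
  \<comment> \<open>\<open>f\<close> separates the cycle through \<open>i\<close> from the rest and
    \<open>g\<close> composes the two again; they are the mutually inverse reindexing maps.\<close>
  define f where "f = (\<lambda>s. (cycle_tail s i, perm_restrict s (S - insert i (set (cycle_tail s i)))))"
  define g where "g = (\<lambda>(w, s'). cycle_of_list (i # w) \<circ> (s' :: nat \<Rightarrow> nat))"
  have f_in: "f s \<in> X" if s: "s permutes S" for s
  proof -
    have orb: "insert i (set (cycle_tail s i)) = orbit s i"
      using set_cycle_tail[OF perm[OF s]] orbit_altdef_permutation[OF perm[OF s]] by metis
    have "set (cycle_tail s i) \<subseteq> S" using permutes_orbit_subset[OF s i] orb by blast
    moreover have "perm_restrict s (S - orbit s i) permutes (S - orbit s i)"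
      using perm_restrict_diff_cyclic[OF s cyclic_on_orbit[OF s fin]] .
    ultimately show ?thesis unfolding f_def X_def using cycle_tail(2)[OF perm[OF s], of i] orb
      by (auto simp: simple_lists_def)
  qed
  have g_perm: "g (w, s') permutes S" and g_cyc: "cycles_along (g (w, s')) (i # w)"
    and g_T: "\<And>x. x \<in> S - insert i (set w) \<Longrightarrow> g (w, s') x = s' x"
    and w_d: "distinct (i # w)" "set w \<subseteq> S" and s'_p: "s' permutes (S - insert i (set w))"
    if X: "(w, s') \<in> X" for w s'
  proof -
    show d: "distinct (i # w)" "set w \<subseteq> S" and s'_p: "s' permutes (S - insert i (set w))"
      using X by (auto simp: X_def simple_lists_def)
    have "cycle_of_list (i # w) permutes S"
      using permutes_subset[OF cycle_permutes[of "i # w"]] d i by auto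
    moreover have "s' permutes S" using permutes_subset[OF s'_p] by blast
    ultimately show "g (w, s') permutes S" unfolding g_def by (simp add: permutes_compose)
    show "cycles_along (g (w, s')) (i # w)" unfolding g_def prod.case
      using s'_p d by (intro cycles_along_cycle_of_list) (auto simp: permutes_def)
    fix x assume x: "x \<in> S - insert i (set w)"
    then have "s' x \<in> S - insert i (set w)" using permutes_in_image[OF s'_p, of x] by blast
    then show "g (w, s') x = s' x" unfolding g_def using id_outside_supp[of "s' x" "i # w"] by simp
  qed
  have gf: "g (f s) = s" if s: "s permutes S" for s
  proof
    fix x
    have X: "(fst (f s), snd (f s)) \<in> X" using f_in[OF s] by simp
    have c1: "cycles_along (g (f s)) (i # cycle_tail s i)" using g_cyc[OF X] by (simp add: f_def)
    have c2: "cycles_along s (i # cycle_tail s i)" by (rule cycle_tail[OF perm[OF s]])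
    consider "x \<in> set (i # cycle_tail s i)" | "x \<in> S - insert i (set (cycle_tail s i))" | "x \<notin> S"
      by auto
    then show "g (f s) x = s x"
    proof cases
      case 1
      then show ?thesis using c1 c2 unfolding cycles_along_def by (metis in_set_conv_nth)
    next
      case 2
      then show ?thesis using g_T[OF X, of x] by (simp add: f_def perm_restrict_def)
    next
      case 3
      then show ?thesis using g_perm[OF X] s by (simp add: permutes_def)
    qed
  qed
  have fg: "f (g p) = p" if "p \<in> X" for p
  proof -
    obtain w s' where p: "p = (w, s')" by (cases p)
    note X = that[unfolded p]
    have ct: "cycle_tail (g (w, s')) i = w" by (rule cycle_tail_unique[OF g_cyc[OF X] w_d(1)[OF X]])
    have "perm_restrict (g (w, s')) (S - insert i (set w)) = s'"
      using g_T[OF X] s'_p[OF X] by (auto simp: perm_restrict_def permutes_def)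
    then show ?thesis unfolding p f_def ct by simp
  qed
  have "rdet i S M = (\<Sum>s\<in>{s. s permutes S}. rdet_term i S M s)" by (rule rdet_eq_sum_rdet_term)
  also have "\<dots> = (\<Sum>(w, s')\<in>X. (-1) ^ length w * path_prod M i w i *
      (if S - insert i (set w) = {} then 1
       else rdet_term (Min (S - insert i (set w))) (S - insert i (set w)) M s'))"
  proof (rule sum.reindex_bij_witness[of _ g f])
    show "g (f s) = s" "f s \<in> X" if "s \<in> {s. s permutes S}" for s using that gf f_in by auto
    show "f (g p) = p" "g p \<in> {s. s permutes S}" if "p \<in> X" for p
      using that fg g_perm by (cases p; auto)+
    fix s assume "s \<in> {s. s permutes S}"
    then have s: "s permutes S" by simp
    have X: "(fst (f s), snd (f s)) \<in> X" using f_in[OF s] by simp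
    have "rdet_term i S M s = (-1) ^ length (cycle_tail s i) * path_prod M i (cycle_tail s i) i *
      (if S - insert i (set (cycle_tail s i)) = {} then 1
       else rdet_term (Min (S - insert i (set (cycle_tail s i))))
         (S - insert i (set (cycle_tail s i))) M (snd (f s)))"
      using g_T[OF X] gf[OF s] w_d[OF X] s'_p[OF X]
      by (intro rdet_term_decomp[OF fin s i cycle_tail(1)[OF perm[OF s]]]) (auto simp: f_def)
    then show "(case f s of (w, s') \<Rightarrow> (-1) ^ length w * path_prod M i w i *
      (if S - insert i (set w) = {} then 1
       else rdet_term (Min (S - insert i (set w))) (S - insert i (set w)) M s')) = rdet_term i S M s"
      by (simp add: f_def)
  qed
  also have "\<dots> = (\<Sum>w\<in>simple_lists (S - {i}). \<Sum>s'\<in>{s'. s' permutes (S - insert i (set w))}.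
      (-1) ^ length w * path_prod M i w i *
      (if S - insert i (set w) = {} then 1
       else rdet_term (Min (S - insert i (set w))) (S - insert i (set w)) M s'))"
    unfolding X_def using fin by (intro sum.Sigma[symmetric]) (auto simp: finite_simple_lists finite_permutations)
  also have "\<dots> = (\<Sum>w\<in>simple_lists (S - {i}).
      (-1) ^ length w * path_prod M i w i * hdet (S - insert i (set w)) M)"
    unfolding hdet_eq_sum sum_distrib_left ..
  finally show ?thesis .
qed

section \<open>Quaternion arithmetic\<close>

lemmas quat_op_defs = zero_quat_def one_quat_def plus_quat_def minus_quat_def uminus_quat_def
  times_quat_def qcnj_def

lemma qcnj_simps [simp]:
  "qcnj 0 = 0" "qcnj 1 = 1" "qcnj (qcnj x) = x" "qcnj (- x) = - qcnj x"
  "qcnj (x + y) = qcnj x + qcnj y" "qcnj (x - y) = qcnj x - qcnj y"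
  by (auto simp: quat_op_defs)

lemma qcnj_mult: "qcnj (x * y) = qcnj y * qcnj x"
  by (auto simp: quat_op_defs algebra_simps)

lemma qcnj_sum: "qcnj (sum f A) = (\<Sum>a\<in>A. qcnj (f a))"
  by (induction A rule: infinite_finite_induct) auto

lemma qcnj_minus_one_power [simp]: "qcnj ((-1) ^ n) = (-1) ^ n"
  by (induction n) auto

lemma qcnj_fixed_iff: "qcnj x = x \<longleftrightarrow> x = Quat (qre x) 0 0 0"
  by (cases x) (auto simp: qcnj_def)

lemma qcnj_fixed_commute: "qcnj x = x \<Longrightarrow> x * y = y * x"
  by (cases x; cases y) (auto simp: qcnj_def times_quat_def)

lemma qre_simps [simp]:
  "qre 0 = 0" "qre 1 = 1" "qre (- x) = - qre x"
  "qre (x + y) = qre x + qre y" "qre (x - y) = qre x - qre y" "qre (qcnj x) = qre x"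
  by (auto simp: quat_op_defs)

lemma qre_sum: "qre (sum f A) = (\<Sum>a\<in>A. qre (f a))"
  by (induction A rule: infinite_finite_induct) auto

text \<open>The trace property, a substitute for commutativity: it lets the two arcs of a closed
  walk change places.\<close>

lemma qre_mult_commute: "qre (x * y) = qre (y * x)"
  by (auto simp: quat_op_defs)

lemma qre_mult_fixed: "qcnj y = y \<Longrightarrow> qre (x * y) = qre x * qre y"
  by (cases x; cases y) (auto simp: qcnj_def times_quat_def)

lemma qre_minus_one_power_mult: "qre ((-1) ^ n * x) = (-1) ^ n * qre x"
  by (induction n arbitrary: x) auto

lemma minus_one_power_commute: "(-1) ^ n * (x::'a::ring_1) = x * (-1) ^ n"
  by (induction n) auto

section \<open>Signed walk sums\<close>

lemma simple_lists_decomp_hd: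
  "simple_lists T = insert [] (\<Union>c\<in>T. (#) c ` simple_lists (T - {c}))"
proof (intro set_eqI iffI)
  fix w assume "w \<in> simple_lists T"
  then show "w \<in> insert [] (\<Union>c\<in>T. (#) c ` simple_lists (T - {c}))"
    by (cases w) (auto simp: simple_lists_def)
qed (auto simp: simple_lists_def)

lemma sum_simple_lists_hd:
  fixes f :: "'a list \<Rightarrow> 'b::comm_monoid_add"
  assumes "finite T"
  shows "(\<Sum>w\<in>simple_lists T. f w) = f [] + (\<Sum>c\<in>T. \<Sum>w\<in>simple_lists (T - {c}). f (c # w))"
proof -
  have "(\<Sum>w\<in>(\<Union>c\<in>T. (#) c ` simple_lists (T - {c})). f w)
      = (\<Sum>c\<in>T. \<Sum>w\<in>(#) c ` simple_lists (T - {c}). f w)"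
    using assms by (intro sum.UNION_disjoint) (auto simp: finite_simple_lists)
  also have "\<dots> = (\<Sum>c\<in>T. \<Sum>w\<in>simple_lists (T - {c}). f (c # w))"
    by (simp add: sum.reindex)
  finally show ?thesis
    using assms by (subst simple_lists_decomp_hd, subst sum.insert) (auto simp: finite_simple_lists)
qed

text \<open>Sorts the lists by whether \<open>l\<close> occurs. If it does, it occurs once, so the
  cut into \<open>u\<close> and \<open>v\<close> is unique.\<close>

lemma sum_simple_lists_split:
  fixes f :: "'a list \<Rightarrow> 'b::comm_monoid_add"
  assumes fin: "finite T" and l: "l \<in> T"
  shows "(\<Sum>w\<in>simple_lists T. f w) = (\<Sum>w\<in>simple_lists (T - {l}). f w)
    + (\<Sum>v\<in>simple_lists (T - {l}). \<Sum>u\<in>simple_lists (T - {l} - set v). f (u @ l # v))"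
proof -
  define X where "X = Sigma (simple_lists (T - {l})) (\<lambda>v. simple_lists (T - {l} - set v))"
  have split: "simple_lists T = simple_lists (T - {l}) \<union> {w \<in> simple_lists T. l \<in> set w}"
    by (auto simp: simple_lists_def)
  have "(\<Sum>w\<in>simple_lists T. f w)
      = (\<Sum>w\<in>simple_lists (T - {l}). f w) + (\<Sum>w\<in>{w \<in> simple_lists T. l \<in> set w}. f w)"
    by (subst split, rule sum.union_disjoint) (use fin in \<open>auto simp: finite_simple_lists, auto simp: simple_lists_def\<close>)
  also have "(\<Sum>w\<in>{w \<in> simple_lists T. l \<in> set w}. f w) = (\<Sum>(v, u)\<in>X. f (u @ l # v))"
  proof -
    have "bij_betw (\<lambda>(v, u). u @ l # v) X {w \<in> simple_lists T. l \<in> set w}"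
      unfolding bij_betw_def
    proof
      show "inj_on (\<lambda>(v, u). u @ l # v) X"
      proof (rule inj_onI, clarify)
        fix v u v' u'
        assume "(v, u) \<in> X" and eq: "u @ l # v = u' @ l # v'"
        then have "l \<notin> set u" "l \<notin> set v" by (auto simp: X_def simple_lists_def)
        then show "v = v' \<and> u = u'" using eq by (simp add: append_Cons_eq_iff)
      qed
      show "(\<lambda>(v, u). u @ l # v) ` X = {w \<in> simple_lists T. l \<in> set w}"
      proof (intro set_eqI iffI)
        fix w assume w: "w \<in> {w \<in> simple_lists T. l \<in> set w}"
        then obtain u v where "w = u @ l # v" by (auto dest: split_list)
        then show "w \<in> (\<lambda>(v, u). u @ l # v) ` X"
          using w by (intro image_eqI[of _ _ "(v, u)"]) (auto simp: X_def simple_lists_def)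
      qed (use l in \<open>auto simp: X_def simple_lists_def\<close>)
    qed
    from sum.reindex_bij_betw[OF this, of f] show ?thesis by (simp add: case_prod_unfold)
  qed
  also have "\<dots> = (\<Sum>v\<in>simple_lists (T - {l}). \<Sum>u\<in>simple_lists (T - {l} - set v). f (u @ l # v))"
    unfolding X_def using fin by (intro sum.Sigma[symmetric]) (auto simp: finite_simple_lists)
  finally show ?thesis .
qed

text \<open>Both sides run over all ordered pairs of disjoint simple lists.\<close>

lemma sum_simple_lists_swap:
  fixes g :: "'a list \<Rightarrow> 'a list \<Rightarrow> 'b::comm_monoid_add"
  assumes fin: "finite U"
  shows "(\<Sum>w\<in>simple_lists U. \<Sum>u\<in>simple_lists (U - set w). g w u)
    = (\<Sum>u\<in>simple_lists U. \<Sum>w\<in>simple_lists (U - set u). g w u)"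
proof -
  have "(\<Sum>w\<in>simple_lists U. \<Sum>u\<in>simple_lists (U - set w). g w u)
      = (\<Sum>w\<in>simple_lists U. \<Sum>u\<in>{u \<in> simple_lists U. set w \<inter> set u = {}}. g w u)"
    by (intro sum.cong refl) (auto simp: simple_lists_def)
  also have "\<dots> = (\<Sum>u\<in>simple_lists U. \<Sum>w\<in>{w \<in> simple_lists U. set w \<inter> set u = {}}. g w u)"
    using fin by (intro sum.swap_restrict) (auto simp: finite_simple_lists)
  also have "\<dots> = (\<Sum>u\<in>simple_lists U. \<Sum>w\<in>simple_lists (U - set u). g w u)"
    by (intro sum.cong refl) (auto simp: simple_lists_def)
  finally show ?thesis .
qed

lemma path_prod_append: "path_prod M a (u @ l # v) b = path_prod M a u l * path_prod M l v b"
  by (induction u arbitrary: a) (auto simp: mult.assoc)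

lemma path_prod_cong:
  assumes "\<And>r. r \<in> insert a (set w) \<Longrightarrow> M r = M' r"
  shows "path_prod M a w b = path_prod M' a w b"
  using assms by (induction w arbitrary: a) auto

text \<open>Over a commutative ring this would be the determinant of the submatrix on
  \<open>T\<close> bordered by row \<open>a\<close> and column \<open>b\<close>. For
  \<open>a\<close> in \<open>T\<close> that bordered matrix has a repeated row.\<close>

definition walk_sum :: "qmat \<Rightarrow> nat set \<Rightarrow> nat \<Rightarrow> nat \<Rightarrow> quat" where
  "walk_sum M T a b = (\<Sum>w\<in>simple_lists T. (-1) ^ length w * path_prod M a w b * hdet (T - set w) M)"

lemma rdet_eq_walk_sum:
  assumes "finite S" "i \<in> S"
  shows "rdet i S M = walk_sum M (S - {i}) i i"
  unfolding rdet_cycle_expansion[OF assms] walk_sum_def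
  by (rule sum.cong[OF refl], subst Diff_insert2, rule refl)

lemma hdet_empty [simp]: "hdet {} M = 1"
  by (simp add: hdet_def)

lemma hdet_cong:
  assumes "finite T" "\<And>r. r \<in> T \<Longrightarrow> M r = M' r"
  shows "hdet T M = hdet T M'"
  using assms
proof (induction T rule: finite_psubset_induct)
  case (psubset T)
  show ?case
  proof (cases "T = {}")
    case False
    then have m: "Min T \<in> T" using psubset.hyps by simp
    have "(-1) ^ length w * path_prod M (Min T) w (Min T) * hdet (T - {Min T} - set w) M
      = (-1) ^ length w * path_prod M' (Min T) w (Min T) * hdet (T - {Min T} - set w) M'"
      if "w \<in> simple_lists (T - {Min T})" for w
    proof -
      have "path_prod M (Min T) w (Min T) = path_prod M' (Min T) w (Min T)"
        using that m psubset.prems by (intro path_prod_cong) (auto simp: simple_lists_def)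
      moreover have "hdet (T - {Min T} - set w) M = hdet (T - {Min T} - set w) M'"
        using m psubset.prems by (intro psubset.IH) auto
      ultimately show ?thesis by simp
    qed
    then show ?thesis
      using False by (simp add: hdet_def rdet_eq_walk_sum[OF psubset.hyps(1) m] walk_sum_def)
  qed simp
qed

lemma walk_sum_cong:
  assumes "finite T" "\<And>r. r \<in> insert a T \<Longrightarrow> M r = M' r"
  shows "walk_sum M T a b = walk_sum M' T a b"
  unfolding walk_sum_def
proof (intro sum.cong refl)
  fix w assume w: "w \<in> simple_lists T"
  have "path_prod M a w b = path_prod M' a w b"
    using w assms by (intro path_prod_cong) (auto simp: simple_lists_def)
  moreover have "hdet (T - set w) M = hdet (T - set w) M'"
    using assms by (intro hdet_cong) auto
  ultimately show "(-1) ^ length w * path_prod M a w b * hdet (T - set w) M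
      = (-1) ^ length w * path_prod M' a w b * hdet (T - set w) M'" by simp
qed

text \<open>Cuts a walk at its first intermediate vertex, which exposes the entries of row
  \<open>a\<close> as left factors; the extra vertex accounts for the minus sign.\<close>

lemma walk_sum_first_step:
  assumes "finite T"
  shows "walk_sum M T a b = M a b * hdet T M - (\<Sum>c\<in>T. M a c * walk_sum M (T - {c}) c b)"
proof -
  have "(\<Sum>w\<in>simple_lists (T - {c}). (-1) ^ length (c # w) * path_prod M a (c # w) b * hdet (T - set (c # w)) M)
      = - (M a c * walk_sum M (T - {c}) c b)" for c
    unfolding walk_sum_def sum_distrib_left sum_negf[symmetric]
  proof (intro sum.cong refl)
    fix w
    have "(-1) ^ length w * (M a c * path_prod M c w b) = M a c * ((-1) ^ length w * path_prod M c w b)"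
      by (metis minus_one_power_commute mult.assoc)
    then show "(-1) ^ length (c # w) * path_prod M a (c # w) b * hdet (T - set (c # w)) M
      = - (M a c * ((-1) ^ length w * path_prod M c w b * hdet (T - {c} - set w) M))"
      by (simp add: Diff_insert2[symmetric] mult.assoc[symmetric])
  qed
  then show ?thesis
    unfolding walk_sum_def[of M T a b] by (subst sum_simple_lists_hd[OF assms]) (simp add: sum_negf)
qed

text \<open>A closed walk from \<open>i\<close> uses row \<open>i\<close> only in its first step,
  and the complementary minors avoid \<open>i\<close>. Hence the new row enters linearly from the
  left and everything else is computed from \<open>M\<close>.\<close>

lemma rdet_replace_row:
  assumes fin: "finite S" and i: "i \<in> S"
  shows "rdet i S (replace_row M i z)
    = z i * hdet (S - {i}) M - (\<Sum>c\<in>S - {i}. z c * walk_sum M (S - {i} - {c}) c i)"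
proof -
  let ?N = "replace_row M i z"
  have row: "?N r = M r" if "r \<noteq> i" for r using that by (auto simp: replace_row_def)
  have "rdet i S ?N = ?N i i * hdet (S - {i}) ?N - (\<Sum>c\<in>S - {i}. ?N i c * walk_sum ?N (S - {i} - {c}) c i)"
    unfolding rdet_eq_walk_sum[OF assms] using fin by (intro walk_sum_first_step) simp
  also have "hdet (S - {i}) ?N = hdet (S - {i}) M"
    using fin row by (intro hdet_cong) auto
  also have "(\<Sum>c\<in>S - {i}. ?N i c * walk_sum ?N (S - {i} - {c}) c i)
      = (\<Sum>c\<in>S - {i}. z c * walk_sum M (S - {i} - {c}) c i)"
  proof (intro sum.cong refl)
    fix c assume "c \<in> S - {i}"
    then have "walk_sum ?N (S - {i} - {c}) c i = walk_sum M (S - {i} - {c}) c i"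
      using fin row by (intro walk_sum_cong) auto
    then show "?N i c * walk_sum ?N (S - {i} - {c}) c i = z c * walk_sum M (S - {i} - {c}) c i"
      by (simp add: replace_row_def)
  qed
  finally show ?thesis by (simp add: replace_row_def)
qed

text \<open>A walk from \<open>i\<close> whose first step is taken from row \<open>l\<close> has the
  product of a walk from \<open>l\<close> to \<open>i\<close>.\<close>

lemma rdet_replace_row_eq_walk_sum:
  assumes "finite S" "i \<in> S"
  shows "rdet i S (replace_row M i (M l)) = walk_sum M (S - {i}) l i"
  using assms by (simp add: rdet_replace_row walk_sum_first_step[of "S - {i}" M l])

section \<open>Hermitian matrices\<close>

definition hermitian :: "qmat \<Rightarrow> bool" where
  "hermitian H \<longleftrightarrow> (\<forall>i j. qcnj (H i j) = H j i)"

lemma qcnj_path_prod: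
  assumes "hermitian H"
  shows "qcnj (path_prod H a w b) = path_prod H b (rev w) a"
proof (induction w arbitrary: a)
  case (Cons c w)
  then show ?case using assms by (simp add: qcnj_mult path_prod_append hermitian_def)
qed (use assms in \<open>simp add: hermitian_def\<close>)

text \<open>Conjugation reverses every path, and reversal permutes the simple lists; real
  determinants then move back to the right. Their reality is a hypothesis because the lemma serves
  inside the induction that establishes it.\<close>

lemma qcnj_walk_sum:
  assumes H: "hermitian H" and real: "\<And>T'. T' \<subseteq> T \<Longrightarrow> qcnj (hdet T' H) = hdet T' H"
  shows "qcnj (walk_sum H T a b) = walk_sum H T b a"
proof -
  have "qcnj (walk_sum H T a b) = (\<Sum>w\<in>simple_lists T.
      hdet (T - set w) H * (path_prod H b (rev w) a * (-1) ^ length w))"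
    unfolding walk_sum_def qcnj_sum qcnj_mult qcnj_path_prod[OF H] by (simp add: real)
  also have "\<dots> = (\<Sum>w\<in>simple_lists T. hdet (T - set w) H * (path_prod H b w a * (-1) ^ length w))"
    by (rule sum.reindex_bij_witness[of _ rev rev]) (auto simp: simple_lists_def)
  also have "\<dots> = walk_sum H T b a"
    unfolding walk_sum_def
    by (intro sum.cong refl) (simp add: qcnj_fixed_commute[OF real, OF Diff_subset] minus_one_power_commute)
  finally show ?thesis .
qed

text \<open>All expansions of a Hermitian determinant agree: the closed walks through \<open>i\<close> that avoid
  \<open>j\<close> pair with closed walks through \<open>j\<close> in the complement, those through \<open>j\<close> are cut into two
  arcs; both descriptions are symmetric in \<open>i\<close> and \<open>j\<close> because the real part of a product is
  invariant under cyclic rotation.\<close>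

lemma hermitian_hdet_expansion:
  assumes H: "hermitian H" and "finite S"
  shows "qcnj (hdet S H) = hdet S H \<and> (\<forall>i\<in>S. walk_sum H (S - {i}) i i = hdet S H)"
  using \<open>finite S\<close>
proof (induction S rule: finite_psubset_induct)
  case (psubset S)
  have IHreal: "qcnj (hdet T H) = hdet T H" if "T \<subset> S" for T using psubset.IH that by blast
  have IHexp: "hdet T H = walk_sum H (T - {j}) j j" if "T \<subset> S" "j \<in> T" for T j
    using psubset.IH that by metis
  \<comment> \<open>Reversing closed walks conjugates their sum into itself; only determinants of
    proper subsets of \<open>S\<close> have to be real for this.\<close>
  have real: "qcnj (walk_sum H (S - {i}) i i) = walk_sum H (S - {i}) i i" if "i \<in> S" for i
    by (rule qcnj_walk_sum[OF H]) (use that in \<open>auto intro: IHreal\<close>)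
  define d where "d = (\<lambda>T. qre (hdet T H))"
  have re_walk: "qre (walk_sum H T a b) = (\<Sum>w\<in>simple_lists T. (-1) ^ length w * qre (path_prod H a w b) * d (T - set w))"
    if "T \<subset> S" for T a b
    unfolding walk_sum_def qre_sum d_def
  proof (intro sum.cong refl)
    fix w
    have "T - set w \<subset> S" using that by blast
    then show "qre ((-1) ^ length w * path_prod H a w b * hdet (T - set w) H)
      = (-1) ^ length w * qre (path_prod H a w b) * qre (hdet (T - set w) H)"
      by (simp add: qre_mult_fixed IHreal qre_minus_one_power_mult)
  qed
  \<comment> \<open>In \<open>X\<close> the walk \<open>w\<close> avoids \<open>j\<close>, and the
    minor it leaves is expanded along \<open>j\<close> by the induction hypothesis. In
    \<open>Y\<close> the arcs \<open>u\<close> and \<open>v\<close> meet at \<open>j\<close>, which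
    the \<open>Suc\<close> in the exponent counts.\<close>
  define X where "X = (\<lambda>i j. \<Sum>w\<in>simple_lists (S - {i} - {j}). \<Sum>u\<in>simple_lists (S - {i} - {j} - set w).
      (-1) ^ length w * qre (path_prod H i w i) *
      ((-1) ^ length u * qre (path_prod H j u j) * d (S - {i} - {j} - set w - set u)))"
  define Y where "Y = (\<lambda>i j. \<Sum>v\<in>simple_lists (S - {i} - {j}). \<Sum>u\<in>simple_lists (S - {i} - {j} - set v).
      (-1) ^ Suc (length u + length v) * qre (path_prod H i u j * path_prod H j v i) *
      d (S - {i} - {j} - set v - set u))"
  have decomp: "qre (walk_sum H (S - {i}) i i) = X i j + Y i j"
    if ij: "i \<in> S" "j \<in> S" "i \<noteq> j" for i j
  proof -
    let ?f = "\<lambda>w. (-1) ^ length w * qre (path_prod H i w i) * d (S - {i} - set w)"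
    have "qre (walk_sum H (S - {i}) i i) = (\<Sum>w\<in>simple_lists (S - {i}). ?f w)"
      using ij by (intro re_walk) blast
    also have "\<dots> = (\<Sum>w\<in>simple_lists (S - {i} - {j}). ?f w)
      + (\<Sum>v\<in>simple_lists (S - {i} - {j}). \<Sum>u\<in>simple_lists (S - {i} - {j} - set v). ?f (u @ j # v))"
      using psubset.hyps ij by (intro sum_simple_lists_split) auto
    also have "(\<Sum>w\<in>simple_lists (S - {i} - {j}). ?f w) = X i j"
      unfolding X_def
    proof (intro sum.cong refl)
      fix w assume w: "w \<in> simple_lists (S - {i} - {j})"
      have sub: "S - {i} - set w \<subset> S" "j \<in> S - {i} - set w" using ij w by (auto simp: simple_lists_def)
      have "d (S - {i} - set w) = qre (walk_sum H (S - {i} - set w - {j}) j j)"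
        unfolding d_def by (subst IHexp[OF sub]) simp
      also have "S - {i} - set w - {j} = S - {i} - {j} - set w" by blast
      also have "qre (walk_sum H \<dots> j j) = (\<Sum>u\<in>simple_lists (S - {i} - {j} - set w).
          (-1) ^ length u * qre (path_prod H j u j) * d (S - {i} - {j} - set w - set u))"
        using ij by (intro re_walk) blast
      finally show "?f w = (\<Sum>u\<in>simple_lists (S - {i} - {j} - set w).
        (-1) ^ length w * qre (path_prod H i w i) *
        ((-1) ^ length u * qre (path_prod H j u j) * d (S - {i} - {j} - set w - set u)))"
        by (simp add: sum_distrib_left)
    qed
    also have "(\<Sum>v\<in>simple_lists (S - {i} - {j}). \<Sum>u\<in>simple_lists (S - {i} - {j} - set v). ?f (u @ j # v)) = Y i j"
      unfolding Y_def
    proof (intro sum.cong refl)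
      fix u v
      have "S - {i} - set (u @ j # v) = S - {i} - {j} - set v - set u" by auto
      then show "?f (u @ j # v) = (-1) ^ Suc (length u + length v) *
          qre (path_prod H i u j * path_prod H j v i) * d (S - {i} - {j} - set v - set u)"
        by (simp add: path_prod_append)
    qed
    finally show ?thesis .
  qed
  have comm: "S - {i} - {j} = S - {j} - {i}" for i j by blast
  have fin: "finite (S - {i} - {j})" for i j using psubset.hyps by simp
  have comm': "A - B - C = A - C - B" for A B C :: "nat set" by blast
  have X_sym: "X i j = X j i" for i j
    unfolding X_def comm[of j i]
  proof (subst sum_simple_lists_swap[OF fin], intro sum.cong refl)
    fix u w
    show "(-1) ^ length w * qre (path_prod H i w i) *
        ((-1) ^ length u * qre (path_prod H j u j) * d (S - {i} - {j} - set w - set u))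
      = (-1) ^ length u * qre (path_prod H j u j) *
        ((-1) ^ length w * qre (path_prod H i w i) * d (S - {i} - {j} - set u - set w))"
      unfolding comm'[of _ "set w" "set u"] by (simp only: ac_simps)
  qed
  have Y_sym: "Y i j = Y j i" for i j
    unfolding Y_def comm[of j i]
  proof (subst sum_simple_lists_swap[OF fin], intro sum.cong refl)
    fix u v
    show "(-1) ^ Suc (length u + length v) * qre (path_prod H i u j * path_prod H j v i) *
        d (S - {i} - {j} - set v - set u)
      = (-1) ^ Suc (length v + length u) * qre (path_prod H j v i * path_prod H i u j) *
        d (S - {i} - {j} - set u - set v)"
      unfolding comm'[of _ "set v" "set u"] qre_mult_commute[of "path_prod H i u j"]
        add.commute[of "length u"] ..
  qed
  have eq: "walk_sum H (S - {i}) i i = walk_sum H (S - {j}) j j" if "i \<in> S" "j \<in> S" for i j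
  proof (cases "i = j")
    case False
    then have "qre (walk_sum H (S - {i}) i i) = qre (walk_sum H (S - {j}) j j)"
      using decomp that X_sym Y_sym by metis
    \<comment> \<open>Both walk sums are real, so equal real parts suffice.\<close>
    then show ?thesis using real that qcnj_fixed_iff by metis
  qed simp
  show ?case
  proof (cases "S = {}")
    case False
    then have m: "Min S \<in> S" using psubset.hyps by simp
    have "hdet S H = walk_sum H (S - {Min S}) (Min S) (Min S)"
      using False rdet_eq_walk_sum[OF psubset.hyps(1) m] by (simp add: hdet_def)
    then show ?thesis using eq real m by metis
  qed simp
qed

context
  fixes H :: qmat
  assumes H: "hermitian H"
begin

lemma qcnj_hdet: "finite S \<Longrightarrow> qcnj (hdet S H) = hdet S H"
  by (rule conjunct1[OF hermitian_hdet_expansion[OF H]])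

lemma walk_sum_closed:
  assumes "finite T" "i \<notin> T"
  shows "walk_sum H T i i = hdet (insert i T) H"
proof -
  have "walk_sum H (insert i T - {i}) i i = hdet (insert i T) H"
    by (rule bspec[OF conjunct2[OF hermitian_hdet_expansion[OF H]]]) (use assms(1) in auto)
  also have "insert i T - {i} = T" using assms(2) by blast
  finally show ?thesis .
qed

text \<open>The counterpart of the vanishing of a determinant with two equal rows. A walk that
  returns to \<open>l\<close> is a closed walk \<open>u\<close> at \<open>l\<close> followed by a
  walk \<open>v\<close> that avoids \<open>l\<close>. For fixed \<open>v\<close> the closed walks
  sum to the real determinant of \<open>T - set v\<close>, with the sign opposite to that of the
  walk \<open>v\<close> alone, so the two groups cancel.\<close>

lemma walk_sum_from_inside:
  assumes fin: "finite T" and l: "l \<in> T"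
  shows "walk_sum H T l b = 0"
proof -
  let ?f = "\<lambda>w. (-1) ^ length w * path_prod H l w b * hdet (T - set w) H"
  have "(\<Sum>u\<in>simple_lists (T - {l} - set v). ?f (u @ l # v)) = - ?f v"
    if v: "v \<in> simple_lists (T - {l})" for v
  proof -
    let ?U = "T - {l} - set v"
    have "?f (u @ l # v) = - (((-1) ^ length u * path_prod H l u l * hdet (?U - set u) H) *
        ((-1) ^ length v * path_prod H l v b))" for u
    proof -
      \<comment> \<open>The two path products keep their order; only the signs and the real factor
        \<open>?D\<close> are moved.\<close>
      let ?a = "(-1) ^ length u :: quat" and ?b = "(-1) ^ length v :: quat"
        and ?P = "path_prod H l u l" and ?Q = "path_prod H l v b" and ?D = "hdet (?U - set u) H"
      have T: "T - set (u @ l # v) = ?U - set u" by auto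
      have D: "?D * (?b * ?Q) = ?b * ?Q * ?D"
        by (rule qcnj_fixed_commute[OF qcnj_hdet]) (simp add: fin)
      have "?f (u @ l # v) = - (?a * (?b * ?P) * ?Q * ?D)"
        unfolding T by (simp add: path_prod_append power_add mult.assoc)
      also have "\<dots> = - (?a * ?P * (?b * ?Q * ?D))"
        unfolding minus_one_power_commute[of "length v" ?P] mult.assoc ..
      also have "\<dots> = - (?a * ?P * ?D * (?b * ?Q))"
        unfolding mult.assoc[of "?a * ?P" ?D] D ..
      finally show ?thesis .
    qed
    then have "(\<Sum>u\<in>simple_lists ?U. ?f (u @ l # v))
        = - (walk_sum H ?U l l * ((-1) ^ length v * path_prod H l v b))"
      unfolding walk_sum_def sum_distrib_right sum_negf[symmetric] by (intro sum.cong refl)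
    also have "walk_sum H ?U l l = hdet (T - set v) H"
    proof -
      have "insert l ?U = T - set v" using v l by (auto simp: simple_lists_def)
      moreover have "walk_sum H ?U l l = hdet (insert l ?U) H"
        using fin by (intro walk_sum_closed) auto
      ultimately show ?thesis by (simp only:)
    qed
    also have "hdet (T - set v) H * ((-1) ^ length v * path_prod H l v b) = ?f v"
      by (rule qcnj_fixed_commute[OF qcnj_hdet]) (simp add: fin)
    finally show ?thesis .
  qed
  then have "(\<Sum>v\<in>simple_lists (T - {l}). \<Sum>u\<in>simple_lists (T - {l} - set v). ?f (u @ l # v))
      = - (\<Sum>v\<in>simple_lists (T - {l}). ?f v)"
    unfolding sum_negf[symmetric] by (intro sum.cong refl)
  then show ?thesis
    unfolding walk_sum_def sum_simple_lists_split[OF fin l, of ?f] by (simp only: add.right_inverse)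
qed

end

section \<open>Cofactors and sums of principal minors\<close>

text \<open>For \<open>i\<close> in \<open>S\<close> this is the right coefficient of
  \<open>z j\<close> once row \<open>i\<close> is replaced by \<open>z\<close>, that is, the
  adjugate entry in row \<open>j\<close> and column \<open>i\<close>. The value 0 outside
  \<open>S\<close> lets sums for different \<open>S\<close> share one index range.\<close>

definition cofactor :: "qmat \<Rightarrow> nat set \<Rightarrow> nat \<Rightarrow> nat \<Rightarrow> quat" where
  "cofactor M S i j = (if j = i then hdet (S - {i}) M
     else if j \<in> S then - walk_sum M (S - {i} - {j}) j i else 0)"

lemma rdet_replace_row_eq_sum_cofactor:
  assumes fin: "finite V" and S: "S \<subseteq> V" and i: "i \<in> S"
  shows "rdet i S (replace_row M i z) = (\<Sum>j\<in>V. z j * cofactor M S i j)"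
proof -
  have finS: "finite S" using fin S finite_subset by blast
  have "(\<Sum>j\<in>V. z j * cofactor M S i j) = (\<Sum>j\<in>S. z j * cofactor M S i j)"
    using fin S i by (intro sum.mono_neutral_right) (auto simp: cofactor_def)
  also have "\<dots> = z i * cofactor M S i i + (\<Sum>j\<in>S - {i}. z j * cofactor M S i j)"
    using finS i by (simp add: sum.remove)
  also have "\<dots> = z i * hdet (S - {i}) M - (\<Sum>j\<in>S - {i}. z j * walk_sum M (S - {i} - {j}) j i)"
    by (simp add: cofactor_def sum_negf[symmetric])
  finally show ?thesis using rdet_replace_row[OF finS i] by simp
qed

lemma sum_mult_cofactor:
  assumes "finite V" "S \<subseteq> V" "i \<in> S"
  shows "(\<Sum>j\<in>V. M l j * cofactor M S i j) = walk_sum M (S - {i}) l i"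
  using rdet_replace_row_eq_sum_cofactor[OF assms, of M "M l"]
    rdet_replace_row_eq_walk_sum[OF finite_subset[OF assms(2,1)] assms(3), of M l] by simp

text \<open>The adjugate identity on \<open>S\<close>: the diagonal case is a closed walk sum, and
  off the diagonal the walk starts at an inner vertex.\<close>

lemma hermitian_sum_mult_cofactor:
  assumes H: "hermitian H" and "finite S" "i \<in> S" "l \<in> S"
  shows "(\<Sum>j\<in>S. H l j * cofactor H S i j) = (if l = i then hdet S H else 0)"
proof -
  have "(\<Sum>j\<in>S. H l j * cofactor H S i j) = walk_sum H (S - {i}) l i"
    using assms by (intro sum_mult_cofactor) auto
  also have "\<dots> = (if l = i then hdet S H else 0)"
    using assms walk_sum_closed[OF H, of "S - {i}" i] walk_sum_from_inside[OF H, of "S - {i}" l i]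
    by (simp add: insert_absorb)
  finally show ?thesis .
qed

definition minor_sum :: "qmat \<Rightarrow> nat set \<Rightarrow> nat \<Rightarrow> quat" where
  "minor_sum M V p = (\<Sum>\<alpha>\<in>{\<alpha>. \<alpha> \<subseteq> V \<and> card \<alpha> = p}. hdet \<alpha> M)"

definition cofactor_sum :: "qmat \<Rightarrow> nat set \<Rightarrow> nat \<Rightarrow> nat \<Rightarrow> nat \<Rightarrow> quat" where
  "cofactor_sum M V p i j = (\<Sum>\<alpha>\<in>{\<alpha>. \<alpha> \<subseteq> V \<and> card \<alpha> = p \<and> i \<in> \<alpha>}. cofactor M \<alpha> i j)"

text \<open>This is the coefficient comparison in \<open>(t I + H) Adj(t I + H) = det (t I + H) I\<close>, where
  \<open>minor_sum\<close> and \<open>cofactor_sum\<close> are the coefficients of the determinant and of the adjugate.\<close>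

lemma cofactor_sum_recursion:
  assumes H: "hermitian H" and fin: "finite V" and i: "i \<in> V" and l: "l \<in> V"
  shows "(\<Sum>j\<in>V. H l j * cofactor_sum H V p i j) + cofactor_sum H V (Suc p) i l
    = (if l = i then minor_sum H V p else 0)"
proof -
  let ?K = "\<lambda>p. {\<alpha>. \<alpha> \<subseteq> V \<and> card \<alpha> = p \<and> i \<in> \<alpha>}"
  have finK: "finite {\<alpha>. \<alpha> \<subseteq> V \<and> P \<alpha>}" for P using fin by simp
  have fa: "finite \<alpha>" if "\<alpha> \<subseteq> V" for \<alpha> using that fin finite_subset by blast
  have "(\<Sum>j\<in>V. H l j * cofactor_sum H V p i j) = (\<Sum>\<alpha>\<in>?K p. \<Sum>j\<in>V. H l j * cofactor H \<alpha> i j)"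
    unfolding cofactor_sum_def sum_distrib_left by (rule sum.swap)
  also have "\<dots> = (\<Sum>\<alpha>\<in>?K p. walk_sum H (\<alpha> - {i}) l i)"
    using fin by (intro sum.cong refl sum_mult_cofactor) auto
  finally have 1: "(\<Sum>j\<in>V. H l j * cofactor_sum H V p i j) = (\<Sum>\<alpha>\<in>?K p. walk_sum H (\<alpha> - {i}) l i)" .
  show ?thesis
  proof (cases "l = i")
    case True
    have "(\<Sum>\<alpha>\<in>?K p. walk_sum H (\<alpha> - {i}) i i) = (\<Sum>\<alpha>\<in>?K p. hdet \<alpha> H)"
      using walk_sum_closed[OF H] fa by (intro sum.cong refl) (auto simp: insert_absorb)
    \<comment> \<open>Diagonal cofactors of order \<open>Suc p\<close> are the minors of order
      \<open>p\<close> that avoid \<open>i\<close>, exactly those missing from the first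
      sum.\<close>
    moreover have "cofactor_sum H V (Suc p) i i = (\<Sum>\<alpha>\<in>{\<alpha>. \<alpha> \<subseteq> V \<and> card \<alpha> = p \<and> i \<notin> \<alpha>}. hdet \<alpha> H)"
      unfolding cofactor_sum_def cofactor_def
      by (rule sum.reindex_bij_witness[of _ "insert i" "\<lambda>\<alpha>. \<alpha> - {i}"]) (use i fa in auto)
    moreover have "minor_sum H V p = (\<Sum>\<alpha>\<in>?K p. hdet \<alpha> H) + (\<Sum>\<alpha>\<in>{\<alpha>. \<alpha> \<subseteq> V \<and> card \<alpha> = p \<and> i \<notin> \<alpha>}. hdet \<alpha> H)"
      unfolding minor_sum_def
      by (subst sum.union_disjoint[symmetric]) (use finK in \<open>auto intro!: sum.cong\<close>)
    ultimately show ?thesis using 1 True by simp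
  next
    case False
    \<comment> \<open>If \<open>l\<close> lies in the index set, the walk starts inside and
      contributes 0. Adjoining \<open>l\<close> to the other sets gives the sets of order
      \<open>Suc p\<close> with a nonzero cofactor formula, with opposite sign.\<close>
    let ?B = "{\<alpha>. \<alpha> \<subseteq> V \<and> card \<alpha> = p \<and> i \<in> \<alpha> \<and> l \<notin> \<alpha>}"
    have "(\<Sum>\<alpha>\<in>?K p. walk_sum H (\<alpha> - {i}) l i) = (\<Sum>\<alpha>\<in>?B. walk_sum H (\<alpha> - {i}) l i)"
      using finK fa False by (intro sum.mono_neutral_right) (auto intro!: walk_sum_from_inside[OF H])
    moreover have "cofactor_sum H V (Suc p) i l = (\<Sum>\<alpha>\<in>{\<alpha>. \<alpha> \<subseteq> V \<and> card \<alpha> = Suc p \<and> i \<in> \<alpha> \<and> l \<in> \<alpha>}. cofactor H \<alpha> i l)"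
      unfolding cofactor_sum_def
      using finK False by (intro sum.mono_neutral_right) (auto simp: cofactor_def)
    moreover have "\<dots> = (\<Sum>\<alpha>\<in>?B. - walk_sum H (\<alpha> - {i}) l i)"
    proof (rule sum.reindex_bij_witness[of _ "insert l" "\<lambda>\<alpha>. \<alpha> - {l}"])
      fix \<alpha> assume "\<alpha> \<in> {\<alpha>. \<alpha> \<subseteq> V \<and> card \<alpha> = Suc p \<and> i \<in> \<alpha> \<and> l \<in> \<alpha>}"
      moreover have "\<alpha> - {l} - {i} = \<alpha> - {i} - {l}" by blast
      ultimately show "- walk_sum H (\<alpha> - {l} - {i}) l i = cofactor H \<alpha> i l"
        using False by (simp add: cofactor_def)
    qed (use l fa False in auto)
    ultimately show ?thesis using 1 False by (simp add: sum_negf)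
  qed
qed

lemma cofactor_sum_beyond:
  assumes "finite V" "card V < p"
  shows "cofactor_sum M V p i j = 0"
proof -
  have "{\<alpha>. \<alpha> \<subseteq> V \<and> card \<alpha> = p \<and> i \<in> \<alpha>} = {}"
    using assms(2) by (auto dest: card_mono[OF assms(1)])
  then show ?thesis by (simp only: cofactor_sum_def sum.empty)
qed

section \<open>Definiteness and kernels\<close>

lemma qcnj_mult_self: "qcnj x * x = Quat (qnorm2 x) 0 0 0"
  by (auto simp: quat_op_defs qnorm2_def power2_eq_square)

lemma qnorm2_nonneg [simp]: "0 \<le> qnorm2 x"
  by (simp add: qnorm2_def)

lemma qnorm2_eq_0_iff [simp]: "qnorm2 x = 0 \<longleftrightarrow> x = 0"
  using quat_nsq_nz[of x] by (auto simp: qnorm2_def zero_quat_def)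

lemma sum_qcnj_mult_self_eq_0:
  assumes "finite V" "(\<Sum>a\<in>V. qcnj (f a) * f a) = 0" "a \<in> V"
  shows "f a = 0"
proof -
  have "(\<Sum>a\<in>V. qnorm2 (f a)) = qre (\<Sum>a\<in>V. qcnj (f a) * f a)"
    by (simp add: qre_sum qcnj_mult_self)
  then have "(\<Sum>a\<in>V. qnorm2 (f a)) = 0" using assms by simp
  then show ?thesis using assms(1,3) by (simp add: sum_nonneg_eq_0_iff)
qed

text \<open>From \<open>b = H c\<close> and \<open>H b = 0\<close> the squared norm of
  \<open>b\<close> equals the pairing of \<open>c\<close> with \<open>H b\<close>, which is 0. So
  the kernel of the square of \<open>H\<close> is the kernel of \<open>H\<close>.\<close>

lemma hermitian_square_kernel:
  assumes H: "hermitian H" and fin: "finite V"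
    and b: "\<And>l. l \<in> V \<Longrightarrow> b l = (\<Sum>j\<in>V. H l j * c j)"
    and Hb: "\<And>l. l \<in> V \<Longrightarrow> (\<Sum>j\<in>V. H l j * b j) = 0"
    and l: "l \<in> V"
  shows "b l = 0"
proof -
  have "(\<Sum>l\<in>V. qcnj (b l) * b l) = (\<Sum>l\<in>V. \<Sum>j\<in>V. qcnj (c j) * (H j l * b l))"
    using H by (simp add: b qcnj_sum qcnj_mult sum_distrib_right mult.assoc hermitian_def)
  also have "\<dots> = (\<Sum>j\<in>V. qcnj (c j) * (\<Sum>l\<in>V. H j l * b l))"
    unfolding sum_distrib_left by (rule sum.swap)
  also have "\<dots> = 0" by (simp add: Hb)
  finally show ?thesis using sum_qcnj_mult_self_eq_0[OF fin] l by blast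
qed

lemma hermitian_AAstar: "hermitian (AAstar n A)"
  by (simp add: hermitian_def AAstar_def qcnj_sum qcnj_mult)

text \<open>Writes the form of the Gram matrix as a squared norm; the arbitrary index set
  \<open>V\<close> makes it available for every principal submatrix.\<close>

lemma AAstar_quadratic_form:
  "(\<Sum>l\<in>V. qcnj (v l) * (\<Sum>j\<in>V. AAstar n A l j * v j))
    = (\<Sum>t<n. qcnj (\<Sum>j\<in>V. qcnj (A j t) * v j) * (\<Sum>j\<in>V. qcnj (A j t) * v j))"
proof -
  have "(\<Sum>j\<in>V. AAstar n A l j * v j) = (\<Sum>t<n. A l t * (\<Sum>j\<in>V. qcnj (A j t) * v j))" for l
    unfolding AAstar_def sum_distrib_left sum_distrib_right mult.assoc by (rule sum.swap)
  then have "(\<Sum>l\<in>V. qcnj (v l) * (\<Sum>j\<in>V. AAstar n A l j * v j))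
      = (\<Sum>l\<in>V. \<Sum>t<n. qcnj (v l) * A l t * (\<Sum>j\<in>V. qcnj (A j t) * v j))"
    by (simp add: sum_distrib_left mult.assoc)
  also have "\<dots> = (\<Sum>t<n. \<Sum>l\<in>V. qcnj (v l) * A l t * (\<Sum>j\<in>V. qcnj (A j t) * v j))"
    by (rule sum.swap)
  also have "\<dots> = (\<Sum>t<n. qcnj (\<Sum>j\<in>V. qcnj (A j t) * v j) * (\<Sum>j\<in>V. qcnj (A j t) * v j))"
    by (simp add: sum_distrib_right[symmetric] qcnj_sum qcnj_mult)
  finally show ?thesis .
qed

lemma AAstar_kernel:
  assumes "\<And>l. l \<in> V \<Longrightarrow> (\<Sum>j\<in>V. AAstar n A l j * v j) = 0" and "t < n"
  shows "(\<Sum>j\<in>V. qcnj (A j t) * v j) = 0"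
proof -
  have "(\<Sum>t<n. qcnj (\<Sum>j\<in>V. qcnj (A j t) * v j) * (\<Sum>j\<in>V. qcnj (A j t) * v j)) = 0"
    unfolding AAstar_quadratic_form[symmetric] using assms(1) by simp
  then show ?thesis
    using sum_qcnj_mult_self_eq_0[of "{..<n}" "\<lambda>t. \<Sum>j\<in>V. qcnj (A j t) * v j" t] assms(2) by simp
qed

section \<open>Rank and principal minors of Gram matrices\<close>

text \<open>Principal minors of the Gram matrix select rows of \<open>A\<close>, whereas
  \<open>qrank\<close> counts columns; this is the row side of the comparison.\<close>

definition left_lin_indep_rows :: "nat \<Rightarrow> qmat \<Rightarrow> nat set \<Rightarrow> bool" where
  "left_lin_indep_rows n A S \<longleftrightarrow>
     (\<forall>q :: nat \<Rightarrow> quat. (\<forall>t<n. (\<Sum>r\<in>S. q r * A r t) = 0) \<longrightarrow> (\<forall>r\<in>S. q r = 0))"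

lemma left_lin_indep_rowsD:
  assumes "left_lin_indep_rows n A S" "\<And>t. t < n \<Longrightarrow> (\<Sum>r\<in>S. q r * A r t) = 0" "r \<in> S"
  shows "q r = 0"
  using assms(1)[unfolded left_lin_indep_rows_def, rule_format, of q r] assms(2,3) by simp

lemma left_lin_indep_rows_subset:
  assumes ind: "left_lin_indep_rows n A S" and fin: "finite S" and sub: "S' \<subseteq> S"
  shows "left_lin_indep_rows n A S'"
  unfolding left_lin_indep_rows_def
proof (intro allI impI ballI)
  fix q :: "nat \<Rightarrow> quat" and r
  assume q: "\<forall>t<n. (\<Sum>r\<in>S'. q r * A r t) = 0" and r: "r \<in> S'"
  define q' where "q' = (\<lambda>r. if r \<in> S' then q r else 0)"
  have "(\<Sum>r\<in>S. q' r * A r t) = (\<Sum>r\<in>S'. q r * A r t)" for t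
    using fin sub by (intro sum.mono_neutral_cong_right) (auto simp: q'_def)
  then have "q' r = 0"
    using q r sub left_lin_indep_rowsD[OF ind, of q' r] by (simp add: subset_iff)
  then show "q r = 0" using r by (simp add: q'_def)
qed

text \<open>Induction on the index set. For column \<open>i\<close> of the adjugate, the squared
  norm of its image under the conjugate transpose of \<open>A\<close> is the product of the
  determinants on \<open>T\<close> and on \<open>insert i T\<close>. Entry \<open>i\<close> of this
  column is the determinant on \<open>T\<close>, nonzero by induction, so independence makes the
  image nonzero and the product positive.\<close>

lemma hdet_AAstar_pos:
  assumes "finite S" "left_lin_indep_rows n A S"
  shows "qre (hdet S (AAstar n A)) > 0"
  using assms
proof (induction S rule: finite_induct)
  case (insert i T)
  let ?H = "AAstar n A" and ?S = "insert i T"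
  define x where "x = cofactor ?H ?S i"
  have Hx: "(\<Sum>j\<in>?S. ?H l j * x j) = (if l = i then hdet ?S ?H else 0)" if "l \<in> ?S" for l
    unfolding x_def using hermitian_sum_mult_cofactor[OF hermitian_AAstar, of ?S i l] insert.hyps that by simp
  have xi: "x i = hdet T ?H" using insert.hyps by (simp add: x_def cofactor_def)
  have pos: "qre (hdet T ?H) > 0"
    using insert.IH left_lin_indep_rows_subset[OF insert.prems] insert.hyps by blast
  define b where "b = (\<lambda>t. \<Sum>j\<in>?S. qcnj (A j t) * x j)"
  have form: "(\<Sum>t<n. qcnj (b t) * b t) = hdet T ?H * hdet ?S ?H"
  proof -
    have "(\<Sum>t<n. qcnj (b t) * b t) = (\<Sum>l\<in>?S. qcnj (x l) * (\<Sum>j\<in>?S. ?H l j * x j))"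
      unfolding b_def AAstar_quadratic_form ..
    also have "\<dots> = (\<Sum>l\<in>?S. if l = i then qcnj (x i) * hdet ?S ?H else 0)"
      by (intro sum.cong refl) (simp add: Hx)
    also have "\<dots> = qcnj (x i) * hdet ?S ?H" using insert.hyps by simp
    finally show ?thesis using insert.hyps by (simp add: xi qcnj_hdet[OF hermitian_AAstar])
  qed
  have "\<exists>t<n. b t \<noteq> 0"
  proof (rule ccontr)
    assume "\<not> (\<exists>t<n. b t \<noteq> 0)"
    then have "qcnj (b t) = 0" if "t < n" for t using that by simp
    then have "(\<Sum>j\<in>?S. qcnj (x j) * A j t) = 0" if "t < n" for t
      using that unfolding b_def qcnj_sum qcnj_mult by simp
    then have "qcnj (x i) = 0"
      using left_lin_indep_rowsD[OF insert.prems, of "\<lambda>j. qcnj (x j)" i] by blast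
    then have "qre (qcnj (x i)) = 0" by (simp only: qre_simps(1))
    then have "qre (x i) = 0" by (simp only: qre_simps(6))
    then show False using pos xi by simp
  qed
  then obtain t where t: "t < n" "b t \<noteq> 0" by blast
  then have "0 < (\<Sum>t<n. qnorm2 (b t))"
    by (intro sum_pos2[of _ t]) (auto simp: less_le)
  also have "\<dots> = qre (\<Sum>t<n. qcnj (b t) * b t)" by (simp add: qre_sum qcnj_mult_self)
  also have "\<dots> = qre (hdet T ?H) * qre (hdet ?S ?H)"
    unfolding form using insert.hyps by (intro qre_mult_fixed qcnj_hdet[OF hermitian_AAstar]) simp
  finally show ?case using pos by (simp add: zero_less_mult_iff)
qed simp

text \<open>A relation \<open>q\<close> among the rows annihilates the Gram matrix from the left.
  Multiplying by column \<open>i\<close> of the adjugate leaves \<open>q i\<close> times the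
  determinant, and \<open>i\<close> is chosen with \<open>q i\<close> nonzero.\<close>

lemma hdet_AAstar_eq_0:
  assumes fin: "finite S" and dep: "\<not> left_lin_indep_rows n A S"
  shows "hdet S (AAstar n A) = 0"
proof -
  let ?H = "AAstar n A"
  obtain q i where q: "\<And>t. t < n \<Longrightarrow> (\<Sum>r\<in>S. q r * A r t) = 0" and i: "i \<in> S" "q i \<noteq> 0"
    using dep unfolding left_lin_indep_rows_def by blast
  have qH: "(\<Sum>l\<in>S. q l * ?H l j) = 0" for j
  proof -
    have "(\<Sum>l\<in>S. q l * ?H l j) = (\<Sum>t<n. (\<Sum>l\<in>S. q l * A l t) * qcnj (A j t))"
      unfolding AAstar_def sum_distrib_left sum_distrib_right mult.assoc by (rule sum.swap)
    then show ?thesis using q by simp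
  qed
  have "q i * hdet S ?H = (\<Sum>l\<in>S. if l = i then q i * hdet S ?H else 0)"
    using fin i by simp
  also have "\<dots> = (\<Sum>l\<in>S. q l * (\<Sum>j\<in>S. ?H l j * cofactor ?H S i j))"
    using hermitian_sum_mult_cofactor[OF hermitian_AAstar fin i(1)] by (intro sum.cong refl) simp
  also have "\<dots> = (\<Sum>j\<in>S. (\<Sum>l\<in>S. q l * ?H l j) * cofactor ?H S i j)"
    unfolding sum_distrib_left sum_distrib_right mult.assoc by (rule sum.swap)
  also have "\<dots> = 0" by (simp add: qH)
  finally show ?thesis using i by simp
qed

section \<open>Comparing row and column rank over a division ring\<close>

text \<open>Gaussian elimination, one coordinate at a time: a row \<open>j0\<close> with nonzero
  entry at \<open>i\<close> clears that coordinate in the other rows. All multipliers stay on the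
  left.\<close>

lemma exists_left_relation:
  fixes a :: "'j \<Rightarrow> 'i \<Rightarrow> 'a::division_ring"
  assumes "finite I" "finite J" "card I < card J"
  shows "\<exists>x. (\<exists>j\<in>J. x j \<noteq> 0) \<and> (\<forall>i\<in>I. (\<Sum>j\<in>J. x j * a j i) = 0)"
  using assms
proof (induction I arbitrary: J a rule: finite_induct)
  case empty
  then obtain j where "j \<in> J" by fastforce
  then show ?case by (intro exI[of _ "\<lambda>_. 1"]) auto
next
  case (insert i I)
  show ?case
  proof (cases "\<forall>j\<in>J. a j i = 0")
    case True
    have "card I < card J" using insert by simp
    then show ?thesis using insert.IH[of J a] insert.prems True by auto
  next
    case False
    then obtain j0 where j0: "j0 \<in> J" "a j0 i \<noteq> 0" by blast
    define a' where "a' = (\<lambda>j c. a j c - a j i * inverse (a j0 i) * a j0 c)"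
    have "card I < card (J - {j0})" using insert j0 by simp
    then obtain x where x: "\<exists>j\<in>J - {j0}. x j \<noteq> 0" "\<forall>c\<in>I. (\<Sum>j\<in>J - {j0}. x j * a' j c) = 0"
      using insert.IH[of "J - {j0}" a'] insert.prems by auto
    \<comment> \<open>The weight of \<open>j0\<close> collects the multiples of row
      \<open>j0\<close> that were subtracted in \<open>a'\<close>.\<close>
    define x' where "x' = x(j0 := - (\<Sum>j\<in>J - {j0}. x j * a j i * inverse (a j0 i)))"
    have "(\<Sum>j\<in>J. x' j * a j c) = (\<Sum>j\<in>J - {j0}. x j * a' j c)" for c
    proof -
      have "(\<Sum>j\<in>J. x' j * a j c) = x' j0 * a j0 c + (\<Sum>j\<in>J - {j0}. x j * a j c)"
        using insert.prems j0 by (simp add: sum.remove x'_def)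
      also have "\<dots> = (\<Sum>j\<in>J - {j0}. x j * a' j c)"
        by (simp add: x'_def a'_def sum_distrib_right sum_subtractf right_diff_distrib mult.assoc)
      finally show ?thesis .
    qed
    moreover have "a' j i = 0" for j using j0 by (simp add: a'_def mult.assoc)
    ultimately have "\<forall>c\<in>insert i I. (\<Sum>j\<in>J. x' j * a j c) = 0" using x(2) by simp
    moreover have "\<exists>j\<in>J. x' j \<noteq> 0" using x(1) by (auto simp: x'_def)
    ultimately show ?thesis by blast
  qed
qed

lemma right_lin_indep_cols_span:
  assumes ind: "right_lin_indep_cols m A J" and dep: "\<not> right_lin_indep_cols m A (insert j J)"
    and fin: "finite J"
  shows "\<exists>q. \<forall>r<m. A r j = (\<Sum>c\<in>J. A r c * q c)"
proof -
  have j: "j \<notin> J" using ind dep by (metis insert_absorb)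
  obtain q where q: "\<forall>r<m. (\<Sum>c\<in>insert j J. A r c * q c) = 0" "\<exists>c\<in>insert j J. q c \<noteq> 0"
    using dep unfolding right_lin_indep_cols_def by blast
  have sum: "A r j * q j + (\<Sum>c\<in>J. A r c * q c) = 0" if "r < m" for r
    using q(1) fin j that by simp
  have qj: "q j \<noteq> 0"
  proof
    assume "q j = 0"
    then have "\<forall>c\<in>J. q c = 0" using ind sum unfolding right_lin_indep_cols_def by simp
    then show False using q(2) \<open>q j = 0\<close> by blast
  qed
  show ?thesis
  proof (intro exI allI impI)
    fix r assume "r < m"
    then have "A r j * q j = - (\<Sum>c\<in>J. A r c * q c)"
      using sum by (simp add: eq_neg_iff_add_eq_0)
    then have "A r j * q j * inverse (q j) = - (\<Sum>c\<in>J. A r c * q c) * inverse (q j)" by simp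
    then show "A r j = (\<Sum>c\<in>J. A r c * (- (q c * inverse (q j))))"
      using qj by (simp add: mult.assoc sum_distrib_right sum_negf)
  qed
qed

lemma maximal_right_lin_indep_cols_span:
  assumes ind: "right_lin_indep_cols m A J" and J: "J \<subseteq> {..<n}"
    and max: "\<And>J'. J' \<subseteq> {..<n} \<Longrightarrow> right_lin_indep_cols m A J' \<Longrightarrow> card J' \<le> card J"
    and j: "j < n"
  shows "\<exists>q. \<forall>r<m. A r j = (\<Sum>c\<in>J. A r c * q c)"
proof (cases "j \<in> J")
  case True
  have fin: "finite J" using J finite_subset by blast
  have "A r j = (\<Sum>c\<in>J. A r c * (if c = j then 1 else 0))" for r
    using True fin by (simp add: if_distrib[of "(*) _"] cong: if_cong)
  then show ?thesis by (intro exI[of _ "\<lambda>c. if c = j then 1 else 0"]) blast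
next
  case False
  have fin: "finite J" using J finite_subset by blast
  have "\<not> right_lin_indep_cols m A (insert j J)"
    using max[of "insert j J"] J j False fin by auto
  then show ?thesis using right_lin_indep_cols_span[OF ind _ fin] by blast
qed

text \<open>Conjugation reverses products, so a left relation among rows becomes a right relation,
  with conjugated coefficients, among columns of the conjugate transpose.\<close>

lemma left_lin_indep_rows_conv_cols:
  "left_lin_indep_rows n A S \<longleftrightarrow> right_lin_indep_cols n (\<lambda>r c. qcnj (A c r)) S"
proof -
  have 0: "qcnj x = 0 \<longleftrightarrow> x = 0" for x by (metis qcnj_simps(1,3))
  have eq: "(\<Sum>r\<in>S. qcnj (A r t) * qcnj (q r)) = qcnj (\<Sum>r\<in>S. q r * A r t)" for q t
    by (simp add: qcnj_sum qcnj_mult)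
  have eq': "(\<Sum>r\<in>S. qcnj (A r t) * q r) = qcnj (\<Sum>r\<in>S. qcnj (q r) * A r t)" for q t
    by (simp add: qcnj_sum qcnj_mult)
  show ?thesis
  proof
    assume L: "left_lin_indep_rows n A S"
    show "right_lin_indep_cols n (\<lambda>r c. qcnj (A c r)) S"
      unfolding right_lin_indep_cols_def eq' 0
      using left_lin_indep_rowsD[OF L, of "\<lambda>r. qcnj (q r)" for q] 0 by simp
  next
    assume R: "right_lin_indep_cols n (\<lambda>r c. qcnj (A c r)) S"
    show "left_lin_indep_rows n A S"
      unfolding left_lin_indep_rows_def
    proof (intro allI impI)
      fix q :: "nat \<Rightarrow> quat"
      assume "\<forall>t<n. (\<Sum>r\<in>S. q r * A r t) = 0"
      then have "\<forall>t<n. (\<Sum>r\<in>S. qcnj (A r t) * qcnj (q r)) = 0" by (simp add: eq)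
      then have "\<forall>r\<in>S. qcnj (q r) = 0"
        using R[unfolded right_lin_indep_cols_def, rule_format, of "\<lambda>r. qcnj (q r)"] by blast
      then show "\<forall>r\<in>S. q r = 0" by (simp add: 0)
    qed
  qed
qed

lemma qrank_maximal_cols:
  obtains J where "J \<subseteq> {..<n}" "right_lin_indep_cols m A J" "card J = qrank m n A"
    "\<And>J'. J' \<subseteq> {..<n} \<Longrightarrow> right_lin_indep_cols m A J' \<Longrightarrow> card J' \<le> card J"
proof -
  let ?C = "{card J | J. J \<subseteq> {..<n} \<and> right_lin_indep_cols m A J}"
  have fin: "finite ?C" by (rule finite_subset[of _ "card ` Pow {..<n}"]) auto
  have "card ({}::nat set) \<in> ?C" by (intro CollectI exI[of _ "{}"]) (simp add: right_lin_indep_cols_def)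
  then have "Max ?C \<in> ?C" using fin by (intro Max_in) auto
  then obtain J where J: "J \<subseteq> {..<n}" "right_lin_indep_cols m A J" "card J = Max ?C" by auto
  moreover have "card J' \<le> Max ?C" if "J' \<subseteq> {..<n}" "right_lin_indep_cols m A J'" for J'
    using fin that by (intro Max_ge) auto
  ultimately show ?thesis using that unfolding qrank_def by metis
qed

text \<open>Counting gives a left relation on the columns of a maximal independent set. The other
  columns are right combinations of these, so the relation persists on them.\<close>

lemma left_dependent_rows_above_qrank:
  assumes S: "S \<subseteq> {..<m}" and card: "qrank m n A < card S"
  shows "\<not> left_lin_indep_rows n A S"
proof -
  obtain J where J: "J \<subseteq> {..<n}" "right_lin_indep_cols m A J" "card J = qrank m n A"
    and max: "\<And>J'. J' \<subseteq> {..<n} \<Longrightarrow> right_lin_indep_cols m A J' \<Longrightarrow> card J' \<le> card J"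
    by (rule qrank_maximal_cols[where m = m and n = n and A = A]) blast
  have "finite J" "finite S" using J S finite_subset by blast+
  then obtain x where x: "\<exists>r\<in>S. x r \<noteq> 0" "\<forall>c\<in>J. (\<Sum>r\<in>S. x r * A r c) = 0"
    using exists_left_relation[of J S A] card J(3) by auto
  have "(\<Sum>r\<in>S. x r * A r t) = 0" if t: "t < n" for t
  proof -
    obtain q where q: "\<forall>r<m. A r t = (\<Sum>c\<in>J. A r c * q c)"
      using maximal_right_lin_indep_cols_span[OF J(2,1) max t] by blast
    have "(\<Sum>r\<in>S. x r * A r t) = (\<Sum>r\<in>S. \<Sum>c\<in>J. x r * A r c * q c)"
      using q S by (intro sum.cong refl) (auto simp: sum_distrib_left mult.assoc)
    also have "\<dots> = (\<Sum>c\<in>J. (\<Sum>r\<in>S. x r * A r c) * q c)"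
      unfolding sum_distrib_right by (rule sum.swap)
    also have "\<dots> = 0" using x(2) by simp
    finally show ?thesis .
  qed
  then show ?thesis using x(1) unfolding left_lin_indep_rows_def by blast
qed

text \<open>The bound for dependent rows is applied to the conjugate transpose, whose columns are the rows of \<open>A\<close>.\<close>

lemma left_independent_rows_qrank:
  obtains S where "S \<subseteq> {..<m}" "card S = qrank m n A" "left_lin_indep_rows n A S"
proof -
  let ?B = "\<lambda>r c. qcnj (A c r)"
  obtain J where J: "J \<subseteq> {..<n}" "right_lin_indep_cols m A J" "card J = qrank m n A"
    by (rule qrank_maximal_cols[where m = m and n = n and A = A]) blast
  obtain R where R: "R \<subseteq> {..<m}" "left_lin_indep_rows n A R" "card R = qrank n m ?B"
    by (rule qrank_maximal_cols[where m = n and n = m and A = ?B])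
      (auto simp: left_lin_indep_rows_conv_cols)
  have "left_lin_indep_rows m ?B J"
    using J(2) by (simp add: left_lin_indep_rows_conv_cols)
  then have "card J \<le> card R"
    using left_dependent_rows_above_qrank[OF J(1), of m ?B] R(3) by force
  then obtain S where "S \<subseteq> R" "card S = card J" using obtain_subset_with_card_n by metis
  moreover have "finite R" using R finite_subset by blast
  ultimately show ?thesis
    using that[of S] left_lin_indep_rows_subset[OF R(2)] R(1) J(3) by auto
qed

section \<open>Least squares solutions\<close>

lemma qnorm2_add_mult:
  "qnorm2 (x + c * y) = qnorm2 x + 2 * qre (x * qcnj y * qcnj c) + qnorm2 c * qnorm2 y"
  by (cases x; cases c; cases y)
    (simp add: qnorm2_def plus_quat_def times_quat_def qcnj_def power2_eq_square algebra_simps)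

text \<open>With \<open>s\<close> the inner product and \<open>N\<close> the squared norm of
  \<open>v\<close>, the step \<open>- \<tau> * s\<close> changes the squared norm by
  \<open>(\<tau>^2 * N - 2 * \<tau>) * qnorm2 s\<close>. For small positive \<open>\<tau>\<close>
  this is negative unless \<open>s = 0\<close>.\<close>

lemma minimal_norm_orthogonal:
  assumes min: "\<And>c. row_norm n r \<le> row_norm n (\<lambda>t. r t + c * v t)"
  shows "(\<Sum>t<n. r t * qcnj (v t)) = 0"
proof -
  define s where "s = (\<Sum>t<n. r t * qcnj (v t))"
  define N where "N = (\<Sum>t<n. qnorm2 (v t))"
  have N: "N \<ge> 0" by (simp add: N_def sum_nonneg)
  \<comment> \<open>The summand 1 keeps the denominator positive when \<open>v\<close>
    vanishes.\<close>
  define \<tau> where "\<tau> = 1 / (N + 1)"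
  define c where "c = Quat (- \<tau>) 0 0 0 * s"
  have c1: "qnorm2 c = \<tau>\<^sup>2 * qnorm2 s"
    by (simp add: c_def qnorm2_def times_quat_def power_mult_distrib algebra_simps)
  have c2: "qre (s * qcnj c) = - \<tau> * qnorm2 s"
    by (simp add: c_def qnorm2_def times_quat_def qcnj_def power2_eq_square algebra_simps)
  have "(\<Sum>t<n. qnorm2 (r t)) \<le> (\<Sum>t<n. qnorm2 (r t + c * v t))"
    using min[of c] by (simp add: row_norm_def)
  also have "\<dots> = (\<Sum>t<n. qnorm2 (r t)) + 2 * qre (s * qcnj c) + qnorm2 c * N"
    by (simp add: qnorm2_add_mult sum.distrib s_def N_def sum_distrib_left sum_distrib_right qre_sum)
  finally have "0 \<le> (\<tau>\<^sup>2 * N - 2 * \<tau>) * qnorm2 s" unfolding c1 c2 by (simp add: algebra_simps)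
  moreover have "\<tau>\<^sup>2 * N - 2 * \<tau> < 0"
  proof -
    have "\<tau> > 0" "\<tau> * N < 2" using N by (auto simp: \<tau>_def field_simps)
    then have "\<tau> * (\<tau> * N - 2) < 0" by (simp add: mult_pos_neg)
    then show ?thesis by (simp add: power2_eq_square algebra_simps)
  qed
  ultimately have "qnorm2 s \<le> 0" by (simp add: zero_le_mult_iff)
  then have "qnorm2 s = 0" using qnorm2_nonneg[of s] by linarith
  then show ?thesis by (simp add: s_def)
qed

text \<open>Changing coordinate \<open>i\<close> of \<open>x0\<close> by \<open>c\<close> moves the
  residual by \<open>c\<close> times row \<open>i\<close> of \<open>A\<close>, so the minimal
  residual is orthogonal to every row.\<close>

lemma lsq_normal_equations:
  assumes lsq: "lsq_least_norm m n A y x0" and i: "i < m"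
  shows "row_mult_star n y A i = (\<Sum>l<m. x0 l * AAstar n A l i)"
proof -
  have "row_norm n (\<lambda>t. row_mult m x0 A t - y t)
      \<le> row_norm n (\<lambda>t. row_mult m x0 A t - y t + c * A i t)" for c
  proof -
    have "row_mult m (\<lambda>l. x0 l + (if l = i then c else 0)) A t = row_mult m x0 A t + c * A i t" for t
      using i by (simp add: row_mult_def distrib_right sum.distrib if_distrib[of "\<lambda>x. x * _"] cong: if_cong)
    then show ?thesis
      using lsq unfolding lsq_least_norm_def Let_def by (metis (no_types, lifting) ext add_diff_eq diff_add_eq)
  qed
  from minimal_norm_orthogonal[OF this]
  have "row_mult_star n y A i = (\<Sum>t<n. row_mult m x0 A t * qcnj (A i t))"
    by (simp add: row_mult_star_def left_diff_distrib sum_subtractf)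
  also have "\<dots> = (\<Sum>l<m. x0 l * AAstar n A l i)"
    unfolding row_mult_def AAstar_def sum_distrib_left sum_distrib_right mult.assoc by (rule sum.swap)
  finally show ?thesis .
qed

text \<open>Adding multiples of a left null row of \<open>A\<close> keeps the residual and so yields
  further minimizers, among which \<open>x0\<close> has least norm.\<close>

lemma lsq_orthogonal_kernel:
  assumes lsq: "lsq_least_norm m n A y x0" and v: "\<And>t. t < n \<Longrightarrow> (\<Sum>l<m. v l * A l t) = 0"
  shows "(\<Sum>l<m. x0 l * qcnj (v l)) = 0"
proof (rule minimal_norm_orthogonal)
  fix c
  let ?x = "\<lambda>t. x0 t + c * v t"
  have "row_mult m ?x A t = row_mult m x0 A t" if "t < n" for t
    using v[OF that] by (simp add: row_mult_def distrib_right sum.distrib mult.assoc sum_distrib_left[symmetric])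
  then have "row_norm n (\<lambda>j. row_mult m ?x A j - y j) = row_norm n (\<lambda>j. row_mult m x0 A j - y j)"
    by (simp add: row_norm_def)
  then show "row_norm m x0 \<le> row_norm m ?x"
    using lsq unfolding lsq_least_norm_def Let_def by auto
qed

section \<open>Minor sums at and above the rank, and Cramer's rule\<close>

lemma minor_sum_AAstar_above_qrank:
  assumes "qrank m n A < p"
  shows "minor_sum (AAstar n A) {..<m} p = 0"
  unfolding minor_sum_def
proof (intro sum.neutral ballI)
  fix \<alpha> assume "\<alpha> \<in> {\<alpha>. \<alpha> \<subseteq> {..<m} \<and> card \<alpha> = p}"
  then show "hdet \<alpha> (AAstar n A) = 0"
    using assms left_dependent_rows_above_qrank[of \<alpha> m n A] finite_subset[of \<alpha> "{..<m}"]
    by (intro hdet_AAstar_eq_0) auto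
qed

text \<open>No minor has negative real part, and a maximal independent set of rows contributes a
  positive one.\<close>

lemma minor_sum_AAstar_qrank:
  "minor_sum (AAstar n A) {..<m} (qrank m n A) \<noteq> 0"
proof -
  obtain S where S: "S \<subseteq> {..<m}" "card S = qrank m n A" "left_lin_indep_rows n A S"
    by (rule left_independent_rows_qrank)
  have "0 < qre (minor_sum (AAstar n A) {..<m} (qrank m n A))"
    unfolding minor_sum_def qre_sum
  proof (rule sum_pos2[of _ S])
    show "0 < qre (hdet S (AAstar n A))" using S finite_subset by (intro hdet_AAstar_pos) auto
    fix \<alpha> assume "\<alpha> \<in> {\<alpha>. \<alpha> \<subseteq> {..<m} \<and> card \<alpha> = qrank m n A}"
    then have "finite \<alpha>" using finite_subset by auto
    then show "0 \<le> qre (hdet \<alpha> (AAstar n A))"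
      using hdet_AAstar_pos[of \<alpha> n A] hdet_AAstar_eq_0[of \<alpha> n A] by fastforce
  qed (use S in auto)
  then show ?thesis by auto
qed

text \<open>Above the rank the recursion reads \<open>C (p + 1) = - H C p\<close> and terminates at \<open>p = m\<close>, so every
  column of \<open>C p\<close> is killed by a power of \<open>H\<close>, hence by \<open>H\<close>.\<close>

lemma AAstar_mult_cofactor_sum_above_qrank:
  assumes "qrank m n A < p" and i: "i < m" and l: "l < m"
  shows "(\<Sum>j<m. AAstar n A l j * cofactor_sum (AAstar n A) {..<m} p i j) = 0"
  using assms(1,3)
\<comment> \<open>Descending induction on \<open>p\<close>: the measure is 0 exactly when
  \<open>p\<close> exceeds \<open>m\<close>, where no index sets are left.\<close>
proof (induction "Suc m - p" arbitrary: p l)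
  case 0
  then show ?case by (simp add: cofactor_sum_beyond)
next
  case (Suc d)
  let ?H = "AAstar n A" and ?C = "cofactor_sum (AAstar n A) {..<m}"
  define b where "b = (\<lambda>l. \<Sum>j<m. ?H l j * ?C p i j)"
  have b: "b l = - ?C (Suc p) i l" if "l < m" for l
    using cofactor_sum_recursion[OF hermitian_AAstar, of "{..<m}" i l n A p]
      minor_sum_AAstar_above_qrank[OF Suc.prems(1)] that i
    by (simp add: b_def eq_neg_iff_add_eq_0)
  have "(\<Sum>j<m. ?H l' j * b j) = 0" if "l' < m" for l'
  proof -
    have "(\<Sum>j<m. ?H l' j * b j) = - (\<Sum>j<m. ?H l' j * ?C (Suc p) i j)"
      by (simp add: b sum_negf)
    also have "\<dots> = 0" using Suc.hyps(1)[of "Suc p" l'] Suc.hyps(2) Suc.prems that by simp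
    finally show ?thesis .
  qed
  then have "b l = 0"
    using hermitian_square_kernel[OF hermitian_AAstar, of "{..<m}" b n A "?C p i" l] Suc.prems
    by (simp add: b_def)
  then show ?case by (simp add: b_def)
qed

lemma lsq_least_norm_cramer:
  assumes lsq: "lsq_least_norm m n A y x0" and k: "qrank m n A = k" and i: "i < m"
  shows "x0 i = (\<Sum>\<alpha>\<in>{\<alpha>. \<alpha> \<subseteq> {..<m} \<and> card \<alpha> = k \<and> i \<in> \<alpha>}.
      rdet i \<alpha> (replace_row (AAstar n A) i (row_mult_star n y A)))
    / (\<Sum>\<alpha>\<in>{\<alpha>. \<alpha> \<subseteq> {..<m} \<and> card \<alpha> = k}. hdet \<alpha> (AAstar n A))"
proof -
  let ?H = "AAstar n A" and ?C = "cofactor_sum (AAstar n A) {..<m}" and ?z = "row_mult_star n y A"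
  let ?d = "minor_sum ?H {..<m} k"
  \<comment> \<open>Column \<open>i\<close> of the cofactor sums of order \<open>Suc k\<close> lies
    in the kernel of the Gram matrix, hence in that of the conjugate transpose of \<open>A\<close>.
    Its conjugate is a left null row of \<open>A\<close>, to which \<open>x0\<close> is
    orthogonal.\<close>
  have "(\<Sum>j<m. qcnj (A j t) * ?C (Suc k) i j) = 0" if "t < n" for t
    using AAstar_kernel[of "{..<m}" n A "?C (Suc k) i" t]
      AAstar_mult_cofactor_sum_above_qrank[of m n A "Suc k" i] k i that by simp
  then have "qcnj (\<Sum>j<m. qcnj (A j t) * ?C (Suc k) i j) = 0" if "t < n" for t
    using that by simp
  then have "(\<Sum>j<m. qcnj (?C (Suc k) i j) * A j t) = 0" if "t < n" for t
    using that by (simp add: qcnj_sum qcnj_mult)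
  from lsq_orthogonal_kernel[OF lsq this]
  have orth: "(\<Sum>l<m. x0 l * ?C (Suc k) i l) = 0" by simp
  have "(\<Sum>\<alpha>\<in>{\<alpha>. \<alpha> \<subseteq> {..<m} \<and> card \<alpha> = k \<and> i \<in> \<alpha>}. rdet i \<alpha> (replace_row ?H i ?z))
      = (\<Sum>\<alpha>\<in>{\<alpha>. \<alpha> \<subseteq> {..<m} \<and> card \<alpha> = k \<and> i \<in> \<alpha>}. \<Sum>j<m. ?z j * cofactor ?H \<alpha> i j)"
    by (intro sum.cong refl rdet_replace_row_eq_sum_cofactor) auto
  also have "\<dots> = (\<Sum>j<m. ?z j * ?C k i j)"
    unfolding cofactor_sum_def sum_distrib_left by (rule sum.swap)
  also have "\<dots> = (\<Sum>j<m. \<Sum>l<m. x0 l * (?H l j * ?C k i j))"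
    using lsq_normal_equations[OF lsq] by (simp add: sum_distrib_right mult.assoc)
  also have "\<dots> = (\<Sum>l<m. x0 l * (\<Sum>j<m. ?H l j * ?C k i j))"
    unfolding sum_distrib_left by (rule sum.swap)
  also have "\<dots> = (\<Sum>l<m. x0 l * ((if l = i then ?d else 0) - ?C (Suc k) i l))"
    using cofactor_sum_recursion[OF hermitian_AAstar, of "{..<m}" i _ n A k] i
    by (intro sum.cong refl arg_cong2[where f = "(*)"]) (auto simp: eq_diff_eq)
  also have "\<dots> = x0 i * ?d"
    using i orth by (simp add: right_diff_distrib sum_subtractf if_distrib[of "(*) _"] cong: if_cong)
  finally have "(\<Sum>\<alpha>\<in>{\<alpha>. \<alpha> \<subseteq> {..<m} \<and> card \<alpha> = k \<and> i \<in> \<alpha>}. rdet i \<alpha> (replace_row ?H i ?z))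
      = x0 i * ?d" .
  moreover have "?d \<noteq> 0" using minor_sum_AAstar_qrank[of n A m] unfolding k .
  ultimately show ?thesis
    \<comment> \<open>Division is multiplication by the inverse from the right, the side on which
      \<open>?d\<close> stands.\<close>
    unfolding minor_sum_def[symmetric] by (simp add: divide_quat_def mult.assoc)
qed

theorem theorem5p4:
  fixes m n k :: nat and A :: qmat and y x0 :: qrow
  assumes lsq: "lsq_least_norm m n A y x0"
  shows "(qrank m n A = m \<longrightarrow>
            (\<forall>i<m. x0 i = rdet i {..<m} (replace_row (AAstar n A) i (row_mult_star n y A))
                            / ddet m n A))
       \<and> (qrank m n A = k \<and> k \<le> n \<and> n < m \<longrightarrow>
            (\<forall>i<m. x0 i =
               (\<Sum>\<alpha>\<in>{\<alpha>. \<alpha> \<subseteq> {..<m} \<and> card \<alpha> = k \<and> i \<in> \<alpha>}.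
                   rdet i \<alpha> (replace_row (AAstar n A) i (row_mult_star n y A)))
               / (\<Sum>\<alpha>\<in>{\<alpha>. \<alpha> \<subseteq> {..<m} \<and> card \<alpha> = k}. hdet \<alpha> (AAstar n A))))"
proof (intro conjI impI allI)
  fix i assume m: "qrank m n A = m" and i: "i < m"
  \<comment> \<open>For rank \<open>m\<close> both sums have the single index set
    \<open>{..<m}\<close>, so the general formula reduces to the first claim.\<close>
  have "\<alpha> = {..<m}" if "\<alpha> \<subseteq> {..<m}" "card \<alpha> = m" for \<alpha>
    using card_subset_eq[of "{..<m}" \<alpha>] that by simp
  then have "{\<alpha>. \<alpha> \<subseteq> {..<m} \<and> card \<alpha> = m} = {{..<m}}"
    "{\<alpha>. \<alpha> \<subseteq> {..<m} \<and> card \<alpha> = m \<and> i \<in> \<alpha>} = {{..<m}}" using i by auto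
  then show "x0 i = rdet i {..<m} (replace_row (AAstar n A) i (row_mult_star n y A)) / ddet m n A"
    using lsq_least_norm_cramer[OF lsq m i] by (simp add: ddet_def)
qed (use lsq_least_norm_cramer[OF lsq] in blast)

end
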